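(* Let $K$ be a locally compact Hausdorff space of class $\mathcal K_{\mathrm{IV}}$. Then $C_0(K)$, regarded as a Hilbert module over the unitalization $\dot{C_0}(K)$ of $C_0(K)$, has no frame (standard or non-standard).
   Context: Class $\mathcal K_{\mathrm{IV}}$: a locally compact Hausdorff space $K$ such that for every $\sigma$-compact subset $S\subset K$ (countable union of compact sets) the complement $K\setminus S$ has nonempty interior in $K$ and the point at infinity is an interior point of $\alpha K\setminus S$, where $\alpha K$ is the one-point compactification; equivalently, $K$ is non-compact and every $\sigma$-compact subset of $K$ has compact closure in $K$. $C_0(K)$ is the $C^*$-algebra of complex continuous functions on $K$ vanishing at infinity; it is a Hilbert module over itself, and over its unitalization, with inner product $\langle x,y\rangle=\overline{x}\,y$. $\dot{\mathcal A}$ denotes the unitalization of a $C^*$-algebra $\mathcal A$ (equal to $\mathcal A$ if $\mathcal A$ is unital). Frames: let $\mathcal N$ be a Hilbert $C^*$-module over a unital $C^*$-algebra $\mathcal A$. A family $\{x_j\}_{j\in J}$ (any index set) in $\mathcal N$ is a standard frame if there are constants $c_1,c_2>0$ such that for every $x\in\mathcal N$ the series $\sum_j\langle x,x_j\rangle\langle x_j,x\rangle$ converges in norm in $\mathcal A$ and $c_1\langle x,x\rangle\le\sum_j\langle x,x_j\rangle\langle x_j,x\rangle\le c_2\langle x,x\rangle$. It is a non-standard frame if the same holds with norm convergence replaced by convergence, in the ultraweak ($\sigma$-weak) topology, of the net of all finite partial sums to an element of the universal enveloping von Neumann algebra $\mathcal A''$ (the inequalities being understood in $\mathcal A''$). "Frame"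 means at least non-standard, i.e. the series converges at least ultraweakly. For a Hilbert module over a non-unital $\mathcal A$, frames are understood by viewing it as a module over $\dot{\mathcal A}$. *)

theory Defs
  imports "HOL-Analysis.Analysis" "HOL-Algebra.Module"
begin

section \<open>Spaces of class \<open>K\<^sub>I\<^sub>V\<close>\<close>

definition sigma_compact_in :: "'k topology \<Rightarrow> 'k set \<Rightarrow> bool" where
  "sigma_compact_in K S \<longleftrightarrow> (\<exists>\<C>. countable \<C> \<and> (\<forall>C\<in>\<C>. compactin K C) \<and> S = \<Union>\<C>)"

definition class_K_IV :: "'k topology \<Rightarrow> bool" where
  "class_K_IV K \<longleftrightarrow> locally_compact_space K \<and> Hausdorff_space K \<and>
     (\<forall>S. sigma_compact_in K S \<longrightarrow>
        K interior_of (topspace K - S) \<noteq> {} \<and>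
        None \<in> Alexandroff_compactification K interior_of
                 (topspace (Alexandroff_compactification K) - Some ` S))"

section \<open>Algebras and modules\<close>

text \<open>A not necessarily unital \<open>C\<^sup>*\<close>-algebra; the field \<open>one\<close> is meaningful only for
  a unital algebra.\<close>

record 'a star_algebra = "(complex, 'a) module" +
  star :: "'a \<Rightarrow> 'a"
  anorm :: "'a \<Rightarrow> real"

text \<open>A (semi-)inner product module over \<open>'a\<close>, with an inner product that is linear in the second
  argument; (pre-)Hilbert spaces are the case \<open>'a = complex\<close>. The fields \<open>mult\<close> and \<open>one\<close>
  inherited from \<^const>\<open>module\<close> play no role.\<close>

record ('a, 'b) ip_module = "('a, 'b) module" +
  ip :: "'b \<Rightarrow> 'b \<Rightarrow> 'a"

definition alg_le :: "('a, 'm) star_algebra_scheme \<Rightarrow> 'a \<Rightarrow> 'a \<Rightarrow> bool" where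
  "alg_le A a b \<longleftrightarrow> a \<in> carrier A \<and> b \<in> carrier A \<and>
     (\<exists>d\<in>carrier A. b \<ominus>\<^bsub>A\<^esub> a = star A d \<otimes>\<^bsub>A\<^esub> d)"

definition is_unit_of :: "('a, 'm) star_algebra_scheme \<Rightarrow> 'a \<Rightarrow> bool" where
  "is_unit_of A e \<longleftrightarrow>
     e \<in> carrier A \<and> (\<forall>a\<in>carrier A. e \<otimes>\<^bsub>A\<^esub> a = a \<and> a \<otimes>\<^bsub>A\<^esub> e = a)"

text \<open>\<open>(a, c)\<close> stands for \<open>a + c 1\<close>. If \<open>A\<close> has a unit already, no unit is adjoined and
  \<open>A\<close> is identified with \<open>A \<times> {0}\<close>; the formula for the norm is correct in both cases.\<close>

definition unitalization ::
    "('a, 'm) star_algebra_scheme \<Rightarrow> ('a \<times> complex) star_algebra" where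
  "unitalization A =
    \<lparr> carrier = (if \<exists>e. is_unit_of A e then carrier A \<times> {0} else carrier A \<times> UNIV),
      mult = (\<lambda>(a, c) (b, d). (a \<otimes>\<^bsub>A\<^esub> b \<oplus>\<^bsub>A\<^esub> c \<odot>\<^bsub>A\<^esub> b \<oplus>\<^bsub>A\<^esub> d \<odot>\<^bsub>A\<^esub> a, c * d)),
      one = (if \<exists>e. is_unit_of A e then (THE e. is_unit_of A e, 0) else (\<zero>\<^bsub>A\<^esub>, 1)),
      zero = (\<zero>\<^bsub>A\<^esub>, 0),
      add = (\<lambda>(a, c) (b, d). (a \<oplus>\<^bsub>A\<^esub> b, c + d)),
      smult = (\<lambda>z (a, c). (z \<odot>\<^bsub>A\<^esub> a, z * c)),
      star = (\<lambda>(a, c). (star A a, cnj c)),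
      anorm = (\<lambda>(a, c). SUP b\<in>{b \<in> carrier A. anorm A b \<le> 1}.
                 anorm A (a \<otimes>\<^bsub>A\<^esub> b \<oplus>\<^bsub>A\<^esub> c \<odot>\<^bsub>A\<^esub> b)) \<rparr>"

text \<open>A \<open>C\<^sup>*\<close>-algebra \<open>A\<close> as a Hilbert module over its unitalization, with
  \<open>\<langle>x, y\<rangle> = x\<^sup>* y\<close>.\<close>

definition self_module ::
    "('a, 'm) star_algebra_scheme \<Rightarrow> ('a \<times> complex, 'a) ip_module" where
  "self_module A =
    \<lparr> carrier = carrier A, mult = undefined, one = undefined,
      zero = \<zero>\<^bsub>A\<^esub>, add = add A,
      smult = (\<lambda>(a, c) x. a \<otimes>\<^bsub>A\<^esub> x \<oplus>\<^bsub>A\<^esub> c \<odot>\<^bsub>A\<^esub> x),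
      ip = (\<lambda>x y. (star A x \<otimes>\<^bsub>A\<^esub> y, 0)) \<rparr>"

text \<open>Continuous functions on \<open>K\<close> vanishing at infinity, extended by \<open>0\<close> outside
  \<open>topspace K\<close>, so that the supremum over the whole type is the supremum norm.\<close>

definition C0 :: "'k topology \<Rightarrow> ('k \<Rightarrow> complex) star_algebra" where
  "C0 K =
    \<lparr> carrier = {f. continuous_map K euclidean f \<and> (\<forall>k. k \<notin> topspace K \<longrightarrow> f k = 0) \<and>
                    (\<forall>\<epsilon>>0. \<exists>C. compactin K C \<and> (\<forall>k\<in>topspace K - C. cmod (f k) < \<epsilon>))},
      mult = (\<lambda>f g k. f k * g k),
      one = indicator (topspace K),
      zero = (\<lambda>k. 0),
      add = (\<lambda>f g k. f k + g k),
      smult = (\<lambda>z f k. z * f k),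
      star = (\<lambda>f k. cnj (f k)),
      anorm = (\<lambda>f. SUP k. cmod (f k)) \<rparr>"

section \<open>Hilbert spaces\<close>

definition hnorm :: "(complex, 'h) ip_module \<Rightarrow> 'h \<Rightarrow> real" where
  "hnorm H v = sqrt (Re (ip H v v))"

subsection \<open>Separation and completion of a semi-inner product space\<close>

definition cauchy_seqs :: "(complex, 'v) ip_module \<Rightarrow> (nat \<Rightarrow> 'v) set" where
  "cauchy_seqs V = {s. range s \<subseteq> carrier V \<and>
     (\<forall>\<epsilon>>0. \<exists>N. \<forall>m\<ge>N. \<forall>n\<ge>N. hnorm V (s m \<ominus>\<^bsub>V\<^esub> s n) < \<epsilon>)}"

definition cauchy_rel :: "(complex, 'v) ip_module \<Rightarrow> (nat \<Rightarrow> 'v) rel" where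
  "cauchy_rel V = {(s, t). s \<in> cauchy_seqs V \<and> t \<in> cauchy_seqs V \<and>
     (\<lambda>n. hnorm V (s n \<ominus>\<^bsub>V\<^esub> t n)) \<longlonglongrightarrow> 0}"

definition cauchy_class :: "(complex, 'v) ip_module \<Rightarrow> (nat \<Rightarrow> 'v) \<Rightarrow> (nat \<Rightarrow> 'v) set" where
  "cauchy_class V s = cauchy_rel V `` {s}"

definition class_rep :: "(nat \<Rightarrow> 'v) set \<Rightarrow> nat \<Rightarrow> 'v" where
  "class_rep X = (SOME s. s \<in> X)"

definition hilbert_completion ::
    "(complex, 'v) ip_module \<Rightarrow> (complex, (nat \<Rightarrow> 'v) set) ip_module" where
  "hilbert_completion V =
    \<lparr> carrier = cauchy_seqs V // cauchy_rel V, mult = undefined, one = undefined,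
      zero = cauchy_class V (\<lambda>n. \<zero>\<^bsub>V\<^esub>),
      add = (\<lambda>X Y. cauchy_class V (\<lambda>n. class_rep X n \<oplus>\<^bsub>V\<^esub> class_rep Y n)),
      smult = (\<lambda>z X. cauchy_class V (\<lambda>n. z \<odot>\<^bsub>V\<^esub> class_rep X n)),
      ip = (\<lambda>X Y. lim (\<lambda>n. ip V (class_rep X n) (class_rep Y n))) \<rparr>"

text \<open>The extension to the completion of a bounded linear map on \<open>V\<close>.\<close>

definition completion_map ::
    "(complex, 'v) ip_module \<Rightarrow> ('v \<Rightarrow> 'v) \<Rightarrow> (nat \<Rightarrow> 'v) set \<Rightarrow> (nat \<Rightarrow> 'v) set" where
  "completion_map V T X = cauchy_class V (\<lambda>n. T (class_rep X n))"

subsection \<open>Hilbert space direct sums\<close>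

definition hilbert_sum ::
    "'i set \<Rightarrow> ('i \<Rightarrow> (complex, 'h) ip_module) \<Rightarrow> (complex, 'i \<Rightarrow> 'h) ip_module" where
  "hilbert_sum I H =
    \<lparr> carrier = {\<xi> \<in> \<Pi>\<^sub>E i\<in>I. carrier (H i). (\<lambda>i. (hnorm (H i) (\<xi> i))\<^sup>2) summable_on I},
      mult = undefined, one = undefined,
      zero = (\<lambda>i\<in>I. \<zero>\<^bsub>H i\<^esub>),
      add = (\<lambda>\<xi> \<eta>. \<lambda>i\<in>I. \<xi> i \<oplus>\<^bsub>H i\<^esub> \<eta> i),
      smult = (\<lambda>z \<xi>. \<lambda>i\<in>I. z \<odot>\<^bsub>H i\<^esub> \<xi> i),
      ip = (\<lambda>\<xi> \<eta>. \<Sum>\<^sub>\<infinity>i\<in>I. ip (H i) (\<xi> i) (\<eta> i)) \<rparr>"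

subsection \<open>Bounded operators\<close>

definition bounded_ops :: "(complex, 'h) ip_module \<Rightarrow> ('h \<Rightarrow> 'h) set" where
  "bounded_ops H = {T \<in> carrier H \<rightarrow>\<^sub>E carrier H.
     (\<forall>\<xi>\<in>carrier H. \<forall>\<eta>\<in>carrier H. T (\<xi> \<oplus>\<^bsub>H\<^esub> \<eta>) = T \<xi> \<oplus>\<^bsub>H\<^esub> T \<eta>) \<and>
     (\<forall>z. \<forall>\<xi>\<in>carrier H. T (z \<odot>\<^bsub>H\<^esub> \<xi>) = z \<odot>\<^bsub>H\<^esub> T \<xi>) \<and>
     (\<exists>M. \<forall>\<xi>\<in>carrier H. hnorm H (T \<xi>) \<le> M * hnorm H \<xi>)}"

definition commutant :: "(complex, 'h) ip_module \<Rightarrow> ('h \<Rightarrow> 'h) set \<Rightarrow> ('h \<Rightarrow> 'h) set" where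
  "commutant H M = {T \<in> bounded_ops H. \<forall>S\<in>M. \<forall>\<xi>\<in>carrier H. T (S \<xi>) = S (T \<xi>)}"

definition op_le :: "(complex, 'h) ip_module \<Rightarrow> ('h \<Rightarrow> 'h) \<Rightarrow> ('h \<Rightarrow> 'h) \<Rightarrow> bool" where
  "op_le H S T \<longleftrightarrow> (\<forall>\<xi>\<in>carrier H. ip H \<xi> (T \<xi>) - ip H \<xi> (S \<xi>) \<in> \<real>\<^sub>\<ge>\<^sub>0)"

definition square_summable_seqs :: "(complex, 'h) ip_module \<Rightarrow> (nat \<Rightarrow> 'h) set" where
  "square_summable_seqs H = {\<xi>. range \<xi> \<subseteq> carrier H \<and> summable (\<lambda>n. (hnorm H (\<xi> n))\<^sup>2)}"

text \<open>The weakest topology on \<open>B(H)\<close> making all functionals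
  \<open>T \<mapsto> \<Sum>n. \<langle>\<xi>\<^sub>n, T \<eta>\<^sub>n\<rangle>\<close> with square-summable \<open>\<xi>\<close>, \<open>\<eta>\<close> continuous.\<close>

definition ultraweak_topology :: "(complex, 'h) ip_module \<Rightarrow> ('h \<Rightarrow> 'h) topology" where
  "ultraweak_topology H = topology_generated_by
     {{T \<in> bounded_ops H. (\<Sum>n. ip H (\<xi> n) (T (\<eta> n))) \<in> U} | \<xi> \<eta> U.
        \<xi> \<in> square_summable_seqs H \<and> \<eta> \<in> square_summable_seqs H \<and> open U}"

section \<open>The universal representation and the enveloping von Neumann algebra\<close>

text \<open>Throughout this section \<open>A\<close> is a unital \<open>C\<^sup>*\<close>-algebra.\<close>

definition states :: "'a star_algebra \<Rightarrow> ('a \<Rightarrow> complex) set" where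
  "states A = {\<phi> \<in> extensional (carrier A).
     (\<forall>a\<in>carrier A. \<forall>b\<in>carrier A. \<phi> (a \<oplus>\<^bsub>A\<^esub> b) = \<phi> a + \<phi> b) \<and>
     (\<forall>z. \<forall>a\<in>carrier A. \<phi> (z \<odot>\<^bsub>A\<^esub> a) = z * \<phi> a) \<and>
     (\<forall>a\<in>carrier A. \<phi> (star A a \<otimes>\<^bsub>A\<^esub> a) \<in> \<real>\<^sub>\<ge>\<^sub>0) \<and>
     \<phi> \<one>\<^bsub>A\<^esub> = 1}"

definition gns_pre :: "'a star_algebra \<Rightarrow> ('a \<Rightarrow> complex) \<Rightarrow> (complex, 'a) ip_module" where
  "gns_pre A \<phi> =
    \<lparr> carrier = carrier A, mult = undefined, one = undefined,
      zero = \<zero>\<^bsub>A\<^esub>, add = add A, smult = smult A,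
      ip = (\<lambda>a b. \<phi> (star A a \<otimes>\<^bsub>A\<^esub> b)) \<rparr>"

text \<open>The direct sum of the GNS representations of all states.\<close>

definition univ_space ::
    "'a star_algebra \<Rightarrow> (complex, ('a \<Rightarrow> complex) \<Rightarrow> (nat \<Rightarrow> 'a) set) ip_module" where
  "univ_space A = hilbert_sum (states A) (\<lambda>\<phi>. hilbert_completion (gns_pre A \<phi>))"

definition univ_rep ::
    "'a star_algebra \<Rightarrow> 'a \<Rightarrow>
       (('a \<Rightarrow> complex) \<Rightarrow> (nat \<Rightarrow> 'a) set) \<Rightarrow> (('a \<Rightarrow> complex) \<Rightarrow> (nat \<Rightarrow> 'a) set)" where
  "univ_rep A a = (\<lambda>\<xi>\<in>carrier (univ_space A). \<lambda>\<phi>\<in>states A.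
     completion_map (gns_pre A \<phi>) (\<lambda>b. a \<otimes>\<^bsub>A\<^esub> b) (\<xi> \<phi>))"

definition enveloping_vN ::
    "'a star_algebra \<Rightarrow>
       ((('a \<Rightarrow> complex) \<Rightarrow> (nat \<Rightarrow> 'a) set) \<Rightarrow> (('a \<Rightarrow> complex) \<Rightarrow> (nat \<Rightarrow> 'a) set)) set" where
  "enveloping_vN A =
     commutant (univ_space A) (commutant (univ_space A) (univ_rep A ` carrier A))"

section \<open>Frames in a Hilbert module \<open>N\<close> over a unital \<open>C\<^sup>*\<close>-algebra \<open>A\<close>\<close>

definition frame_sum ::
    "'a star_algebra \<Rightarrow> ('a, 'b) ip_module \<Rightarrow> ('j \<Rightarrow> 'b) \<Rightarrow> 'b \<Rightarrow> 'j set \<Rightarrow> 'a" where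
  "frame_sum A N xs x F = (\<Oplus>\<^bsub>A\<^esub>j\<in>F. ip N x (xs j) \<otimes>\<^bsub>A\<^esub> ip N (xs j) x)"

text \<open>A series over \<open>J\<close> is the net of its partial sums over the finite subsets of \<open>J\<close>.\<close>

definition standard_frame ::
    "'a star_algebra \<Rightarrow> ('a, 'b) ip_module \<Rightarrow> 'j set \<Rightarrow> ('j \<Rightarrow> 'b) \<Rightarrow> bool" where
  "standard_frame A N J xs \<longleftrightarrow> xs \<in> J \<rightarrow> carrier N \<and>
     (\<exists>c1>0. \<exists>c2>0. \<forall>x\<in>carrier N. \<exists>s\<in>carrier A.
        ((\<lambda>F. anorm A (frame_sum A N xs x F \<ominus>\<^bsub>A\<^esub> s)) \<longlongrightarrow> 0) (finite_subsets_at_top J) \<and>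
        alg_le A (complex_of_real c1 \<odot>\<^bsub>A\<^esub> ip N x x) s \<and>
        alg_le A s (complex_of_real c2 \<odot>\<^bsub>A\<^esub> ip N x x))"

definition nonstandard_frame ::
    "'a star_algebra \<Rightarrow> ('a, 'b) ip_module \<Rightarrow> 'j set \<Rightarrow> ('j \<Rightarrow> 'b) \<Rightarrow> bool" where
  "nonstandard_frame A N J xs \<longleftrightarrow> xs \<in> J \<rightarrow> carrier N \<and>
     (\<exists>c1>0. \<exists>c2>0. \<forall>x\<in>carrier N. \<exists>T\<in>enveloping_vN A.
        limitin (subtopology (ultraweak_topology (univ_space A)) (enveloping_vN A))
          (\<lambda>F. univ_rep A (frame_sum A N xs x F)) T (finite_subsets_at_top J) \<and>
        op_le (univ_space A) (univ_rep A (complex_of_real c1 \<odot>\<^bsub>A\<^esub> ip N x x)) T \<and>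
        op_le (univ_space A) T (univ_rep A (complex_of_real c2 \<odot>\<^bsub>A\<^esub> ip N x x)))"

end

theory Submission
  imports Defs
begin

text \<open>Testing a frame \<open>(x\<^sub>j)\<close> at a point \<open>k\<close> gives \<open>0 < \<Sum>\<^sub>j |x\<^sub>j(k)|\<^sup>2 < \<infinity>\<close>; for non-standard frames,
  evaluation at \<open>k\<close> is a state of the unitalization, hence a vector state of the universal
  representation and ultraweakly continuous. So only countably many \<open>x\<^sub>j\<close> are nonzero at \<open>k\<close>, and each
  set \<open>{x\<^sub>j \<noteq> 0}\<close> is \<open>\<sigma>\<close>-compact. One can therefore choose points \<open>k\<^sub>0, k\<^sub>1, \<dots>\<close> successively, each
  outside \<open>{x\<^sub>j \<noteq> 0}\<close> for all \<open>x\<^sub>j\<close> that do not vanish at an earlier point. The set of these points is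
  infinite and contained in a compact set, so it has an accumulation point \<open>k\<close>. Every \<open>x\<^sub>j\<close> is nonzero
  at no more than one \<open>k\<^sub>n\<close>, so it vanishes at \<open>k\<close> by continuity: a contradiction.\<close>

section \<open>The topological argument\<close>

lemma class_K_IV_sigma_compact_bounded:
  assumes "class_K_IV K" "sigma_compact_in K S"
  shows "\<exists>C. compactin K C \<and> S \<subseteq> C"
proof -
  let ?X = "Alexandroff_compactification K"
  have "None \<in> ?X interior_of (topspace ?X - Some ` S)"
    using assms by (simp add: class_K_IV_def)
  then obtain W where W: "openin ?X W" "None \<in> W" "W \<subseteq> topspace ?X - Some ` S"
    by (auto simp: interior_of_def)
  then obtain C where C: "compactin K C" "W = insert None (Some ` (topspace K - C))"
    by (auto simp: openin_Alexandroff_compactification)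
  moreover have "S \<subseteq> topspace K"
    using assms(2) by (auto simp: sigma_compact_in_def dest!: compactin_subset_topspace)
  ultimately have "S \<subseteq> C"
    using W(3) by auto
  with C(1) show ?thesis by blast
qed

lemma class_K_IV_sigma_compact_proper:
  assumes "class_K_IV K" "sigma_compact_in K S"
  shows "\<exists>k\<in>topspace K. k \<notin> S"
proof -
  have "K interior_of (topspace K - S) \<noteq> {}"
    using assms by (simp add: class_K_IV_def)
  moreover have "K interior_of (topspace K - S) \<subseteq> topspace K - S"
    by (rule interior_of_subset)
  ultimately show ?thesis by blast
qed

section \<open>Sigma-compact sets and supports of functions vanishing at infinity\<close>

lemma sigma_compact_in_compactin:
  "compactin K C \<Longrightarrow> sigma_compact_in K C"
  unfolding sigma_compact_in_def by (intro exI[of _ "{C}"]) auto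

lemma sigma_compact_in_UN:
  assumes "countable I" "\<And>i. i \<in> I \<Longrightarrow> sigma_compact_in K (S i)"
  shows "sigma_compact_in K (\<Union>i\<in>I. S i)"
proof -
  from assms(2) have "\<forall>i\<in>I. \<exists>\<C>. countable \<C> \<and> (\<forall>C\<in>\<C>. compactin K C) \<and> S i = \<Union>\<C>"
    by (simp add: sigma_compact_in_def)
  then obtain \<C> where \<C>: "\<And>i. i \<in> I \<Longrightarrow> countable (\<C> i) \<and> (\<forall>C\<in>\<C> i. compactin K C) \<and> S i = \<Union>(\<C> i)"
    by metis
  show ?thesis
    unfolding sigma_compact_in_def
    by (rule exI[of _ "\<Union>i\<in>I. \<C> i"]) (use \<C> assms(1) in auto)
qed

lemma sigma_compact_in_countable:
  assumes "countable S" "S \<subseteq> topspace K"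
  shows "sigma_compact_in K S"
  unfolding sigma_compact_in_def
  by (rule exI[of _ "(\<lambda>k. {k}) ` S"]) (use assms in \<open>auto intro: finite_imp_compactin\<close>)

text \<open>The support is exhausted by the sets where |f| is at least 1/(n+1). Each is closed, and
  by vanishing at infinity it lies in a compact set, hence is compact.\<close>

lemma C0_support_sigma_compact:
  assumes f: "f \<in> carrier (C0 K)"
  shows "sigma_compact_in K {k. f k \<noteq> 0}"
proof -
  let ?S = "\<lambda>n::nat. {k \<in> topspace K. f k \<in> {z. 1 / Suc n \<le> cmod z}}"
  have cont: "continuous_map K euclidean f" and out: "\<And>k. k \<notin> topspace K \<Longrightarrow> f k = 0"
    and van: "\<And>\<epsilon>. \<epsilon> > 0 \<Longrightarrow> \<exists>C. compactin K C \<and> (\<forall>k\<in>topspace K - C. cmod (f k) < \<epsilon>)"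
    using f by (auto simp: C0_def)
  have "compactin K (?S n)" for n
  proof -
    obtain C where C: "compactin K C" "\<forall>k\<in>topspace K - C. cmod (f k) < 1 / Suc n"
      using van[of "1 / Suc n"] by auto
    have "closedin K (?S n)"
      by (rule closedin_continuous_map_preimage[OF cont])
        (auto intro!: closed_Collect_le continuous_intros)
    moreover have "?S n \<subseteq> C"
      using C(2) by force
    ultimately show ?thesis
      using C(1) closed_compactin by blast
  qed
  moreover have "{k. f k \<noteq> 0} = (\<Union>n. ?S n)"
  proof (intro equalityI subsetI)
    fix k assume "k \<in> {k. f k \<noteq> 0}"
    then have "f k \<noteq> 0" by simp
    then have "k \<in> topspace K" "0 < cmod (f k)"
      using out by auto
    moreover obtain n where "1 / Suc n < cmod (f k)"
      using nat_approx_posE[OF \<open>0 < cmod (f k)\<close>] by auto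
    ultimately show "k \<in> (\<Union>n. ?S n)" by (intro UN_I[of n]) simp_all
  qed auto
  ultimately show ?thesis
    by (simp add: sigma_compact_in_UN sigma_compact_in_compactin)
qed

text \<open>Standard and non-standard frames both reduce to this pointwise condition. Finiteness of
  the sums makes each index set \<open>A k\<close> countable; positivity makes it nonempty.\<close>

lemma class_K_IV_not_pointwise_frame:
  assumes K: "class_K_IV K" and xs: "xs \<in> J \<rightarrow> carrier (C0 K)"
    and sq: "\<And>k. k \<in> topspace K \<Longrightarrow> \<exists>L>0. ((\<lambda>j. (cmod (xs j k))\<^sup>2) has_sum L) J"
  shows False
proof -
  define A where "A k = {j \<in> J. xs j k \<noteq> 0}" for k
  have A_countable: "countable (A k)" if k: "k \<in> topspace K" for k
  proof -
    have "countable {j \<in> J. (cmod (xs j k))\<^sup>2 \<noteq> 0}"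
      using sq[OF k] summable_countable_real has_sum_imp_summable by blast
    then show ?thesis by (simp add: A_def)
  qed
  have A_nonempty: "A k \<noteq> {}" if k: "k \<in> topspace K" for k
  proof
    assume "A k = {}"
    then have "((\<lambda>j. (cmod (xs j k))\<^sup>2) has_sum 0) J"
      by (intro has_sum_0) (auto simp: A_def)
    with sq[OF k] show False
      using has_sum_unique by force
  qed
  have "\<exists>p :: nat \<Rightarrow> 'a. \<forall>n. p n \<in> topspace K \<and> (\<forall>m<n. A (p m) \<inter> A (p n) = {})"
  proof (rule dependent_wf_choice[of "less_than"])
    fix n :: nat and p :: "nat \<Rightarrow> 'a"
    assume p: "\<And>m. (m, n) \<in> less_than \<Longrightarrow> p m \<in> topspace K \<and> (\<forall>i<m. A (p i) \<inter> A (p m) = {})"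
    \<comment> \<open>The indices active at an earlier point. They are countably many, so their
      supports together are still sigma-compact and miss some point, which becomes
      \<open>p n\<close>.\<close>
    let ?B = "\<Union>m<n. A (p m)"
    have "countable ?B" using p A_countable by auto
    moreover have "sigma_compact_in K {k. xs j k \<noteq> 0}" if "j \<in> ?B" for j
      using that xs by (intro C0_support_sigma_compact) (auto simp: A_def)
    ultimately have "sigma_compact_in K (\<Union>j\<in>?B. {k. xs j k \<noteq> 0})"
      by (rule sigma_compact_in_UN)
    then obtain k where k: "k \<in> topspace K" "k \<notin> (\<Union>j\<in>?B. {k. xs j k \<noteq> 0})"
      using class_K_IV_sigma_compact_proper[OF K] by blast
    then show "\<exists>k. k \<in> topspace K \<and> (\<forall>m<n. A (p m) \<inter> A k = {})"
      by (intro exI[of _ k]) (auto simp: A_def)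
  qed auto
  then obtain p :: "nat \<Rightarrow> 'a" where p: "\<And>n. p n \<in> topspace K"
    and dis: "\<And>m n. m < n \<Longrightarrow> A (p m) \<inter> A (p n) = {}"
    by blast
  have one: "m = n" if "j \<in> A (p m)" "j \<in> A (p n)" for j m n
    using that dis[of m n] dis[of n m] by (metis disjoint_iff linorder_neqE_nat)
  have "inj p"
    using A_nonempty p one by (metis all_not_in_conv injI)
  then have "infinite (range p)"
    by (simp add: range_inj_infinite)
  \<comment> \<open>A countable set is a countable union of singletons, hence sigma-compact, hence
    inside a compact set; Bolzano-Weierstrass then applies.\<close>
  moreover obtain C where "compactin K C" "range p \<subseteq> C"
    using class_K_IV_sigma_compact_bounded[OF K sigma_compact_in_countable[of "range p" K]] p
    by auto
  ultimately obtain k where k: "k \<in> K derived_set_of (range p)"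
    using compactin_imp_Bolzano_Weierstrass[of K C "range p"] by blast
  then have kK: "k \<in> topspace K"
    and near: "\<And>W. openin K W \<Longrightarrow> k \<in> W \<Longrightarrow> \<exists>n. p n \<in> W \<and> p n \<noteq> k"
    unfolding in_derived_set_of by blast+
  then obtain j where j: "j \<in> J" "xs j k \<noteq> 0"
    using A_nonempty by (auto simp: A_def)
  have cont: "continuous_map K euclidean (xs j)"
    using xs j(1) by (auto simp: C0_def)
  let ?U = "{i \<in> topspace K. xs j i \<in> - {0}}"
  have U: "openin K ?U"
    by (rule openin_continuous_map_preimage[OF cont]) auto
  then obtain n where n: "p n \<in> ?U" "p n \<noteq> k"
    using near[OF U] kK j(2) by auto
  \<comment> \<open>Accumulation is used a second time: deleting the point \<open>p n\<close>
    already found leaves a neighbourhood of \<open>k\<close>, since points are closed. It contains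
    another \<open>p m\<close> where \<open>xs j\<close> is nonzero, but an index is active at one
    point of the sequence only.\<close>
  have "openin K (?U - {p n})"
    using U K p by (intro openin_diff) (auto simp: class_K_IV_def intro: closedin_Hausdorff_singleton)
  moreover have "k \<in> ?U - {p n}"
    using kK j(2) n(2) by auto
  ultimately obtain m where "p m \<in> ?U - {p n}"
    using near by blast
  then show False
    using n(1) one[of j m n] j(1) by (auto simp: A_def)
qed

lemma class_K_IV_noncompact:
  assumes "class_K_IV K"
  shows "\<not> compact_space K"
  using class_K_IV_sigma_compact_proper[OF assms sigma_compact_in_compactin]
  by (auto simp: compact_space_def)

section \<open>The algebra of continuous functions vanishing at infinity\<close>

lemma C0_fields [simp]:
  "f \<otimes>\<^bsub>C0 K\<^esub> g = (\<lambda>k. f k * g k)" "f \<oplus>\<^bsub>C0 K\<^esub> g = (\<lambda>k. f k + g k)"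
  "\<zero>\<^bsub>C0 K\<^esub> = (\<lambda>k. 0)" "z \<odot>\<^bsub>C0 K\<^esub> f = (\<lambda>k. z * f k)"
  "star (C0 K) f = (\<lambda>k. cnj (f k))" "anorm (C0 K) f = (SUP k. cmod (f k))"
  by (simp_all add: C0_def)

text \<open>The common source of the closure properties of \<open>C0 K\<close>: near infinity the
  pair (f, g) is close to the origin, where \<open>G\<close> is continuous with value 0. That value
  also keeps the composite 0 outside \<open>topspace K\<close>.\<close>

lemma C0_image2:
  fixes G :: "complex \<times> complex \<Rightarrow> complex"
  assumes f: "f \<in> carrier (C0 K)" and g: "g \<in> carrier (C0 K)"
    and G: "continuous_on UNIV G" "G (0, 0) = 0"
  shows "(\<lambda>k. G (f k, g k)) \<in> carrier (C0 K)"
proof -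
  have "continuous_map K euclidean (\<lambda>k. (f k, g k))"
    using f g continuous_map_pairedI[of K euclidean f euclidean g] by (auto simp: C0_def)
  then have "continuous_map K euclidean (\<lambda>k. G (f k, g k))"
    using continuous_map_compose[of K euclidean "\<lambda>k. (f k, g k)" euclidean G] G(1)
    by (simp add: o_def)
  moreover have "\<exists>C. compactin K C \<and> (\<forall>k\<in>topspace K - C. cmod (G (f k, g k)) < \<epsilon>)"
    if \<epsilon>: "\<epsilon> > 0" for \<epsilon>
  proof -
    obtain \<delta> where \<delta>: "\<delta> > 0" "\<And>u. dist u (0, 0) < \<delta> \<Longrightarrow> dist (G u) (G (0, 0)) < \<epsilon>"
      using G(1) \<epsilon> unfolding continuous_on_iff by (metis UNIV_I)
    obtain C where C: "compactin K C" "\<And>k. k \<in> topspace K - C \<Longrightarrow> cmod (f k) < \<delta> / 2"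
      using f \<delta>(1) unfolding C0_def by (auto dest!: spec[of _ "\<delta> / 2"])
    obtain D where D: "compactin K D" "\<And>k. k \<in> topspace K - D \<Longrightarrow> cmod (g k) < \<delta> / 2"
      using g \<delta>(1) unfolding C0_def by (auto dest!: spec[of _ "\<delta> / 2"])
    have "cmod (G (f k, g k)) < \<epsilon>" if k: "k \<in> topspace K - (C \<union> D)" for k
    proof -
      have "norm (f k, g k) \<le> cmod (f k) + cmod (g k)"
        by (rule norm_Pair_le)
      also have "\<dots> < \<delta>"
        using C(2)[of k] D(2)[of k] k by auto
      finally have "dist (f k, g k) (0, 0) < \<delta>"
        by (simp add: zero_prod_def[symmetric])
      with \<delta>(2) have "dist (G (f k, g k)) (G (0, 0)) < \<epsilon>" by blast
      then show ?thesis using G(2) by simp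
    qed
    then show ?thesis
      using compactin_Un[OF C(1) D(1)] by blast
  qed
  ultimately show ?thesis
    using f g G(2) by (auto simp: C0_def)
qed

lemma C0_image:
  assumes "f \<in> carrier (C0 K)" "continuous_on UNIV G" "G 0 = 0"
  shows "(\<lambda>k. G (f k)) \<in> carrier (C0 K)"
proof -
  have "continuous_on UNIV (\<lambda>z :: complex \<times> complex. G (fst z))"
    by (rule continuous_on_compose2[OF assms(2)]) (auto intro!: continuous_intros)
  then show ?thesis
    using C0_image2[OF assms(1) assms(1), of "\<lambda>z. G (fst z)"] assms(3) by simp
qed

lemma C0_closed:
  assumes "f \<in> carrier (C0 K)" "g \<in> carrier (C0 K)"
  shows "(\<lambda>k. f k + g k) \<in> carrier (C0 K)" "(\<lambda>k. f k * g k) \<in> carrier (C0 K)"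
    "(\<lambda>k. z * f k) \<in> carrier (C0 K)" "(\<lambda>k. cnj (f k)) \<in> carrier (C0 K)"
proof -
  show "(\<lambda>k. f k + g k) \<in> carrier (C0 K)"
    using C0_image2[OF assms, of "\<lambda>z. fst z + snd z"] by (simp add: continuous_intros)
  show "(\<lambda>k. f k * g k) \<in> carrier (C0 K)"
    using C0_image2[OF assms, of "\<lambda>z. fst z * snd z"] by (simp add: continuous_intros)
  show "(\<lambda>k. z * f k) \<in> carrier (C0 K)"
    using C0_image[OF assms(1), of "\<lambda>w. z * w"] by (simp add: continuous_intros)
  show "(\<lambda>k. cnj (f k)) \<in> carrier (C0 K)"
    using C0_image[OF assms(1), of cnj] by (simp add: continuous_intros)
qed

lemma C0_zero: "(\<lambda>k. 0) \<in> carrier (C0 K)"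
  by (auto simp: C0_def intro!: exI[of _ "{}"])

lemma C0_bounded:
  assumes f: "f \<in> carrier (C0 K)"
  shows "\<exists>B\<ge>0. \<forall>k. cmod (f k) \<le> B"
proof -
  obtain C where C: "compactin K C" "\<And>k. k \<in> topspace K - C \<Longrightarrow> cmod (f k) < 1"
    using f unfolding C0_def by (auto dest!: spec[of _ 1])
  have "compact (f ` C)"
    using image_compactin[OF C(1), of euclidean f] f by (simp add: C0_def)
  then obtain B where B: "\<And>k. k \<in> C \<Longrightarrow> cmod (f k) \<le> B"
    by (meson bounded_iff compact_imp_bounded imageI)
  have "cmod (f k) \<le> max 1 B" for k
  proof (cases "k \<in> topspace K")
    case True
    then show ?thesis using B[of k] C(2)[of k] by (cases "k \<in> C") auto
  next
    case False
    then have "f k = 0" using f by (simp add: C0_def)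
    then show ?thesis by simp
  qed
  then show ?thesis
    by (intro exI[of _ "max 1 B"]) auto
qed

text \<open>Locally compact Hausdorff spaces are completely regular, so some \<open>h\<close> is 0
  at \<open>k\<close> and 1 off a neighbourhood \<open>U\<close> contained in a compact set; 1 - h
  is then the wanted function. Such functions serve both as test vectors for frames and as unit-ball
  elements that detect the value at \<open>k\<close>.\<close>

lemma C0_peak:
  assumes K: "locally_compact_space K" "Hausdorff_space K" and k: "k \<in> topspace K"
  shows "\<exists>b\<in>carrier (C0 K). b k = 1 \<and> (\<forall>i. cmod (b i) \<le> 1)"
proof -
  obtain U L where UL: "openin K U" "compactin K L" "k \<in> U" "U \<subseteq> L"
    using K(1) k unfolding locally_compact_space_def by blast
  have "completely_regular_space K"
    using K completely_regular_eq_regular_space locally_compact_Hausdorff_imp_regular_space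
    by blast
  moreover have "closedin K (topspace K - U)" "k \<in> topspace K - (topspace K - U)"
    using UL k by auto
  ultimately obtain h :: "'a \<Rightarrow> real" where h: "continuous_map K (top_of_set {0..1}) h"
      "h k = 0" "h ` (topspace K - U) \<subseteq> {1}"
    unfolding completely_regular_space_def by blast
  define b where "b i = (if i \<in> topspace K then complex_of_real (1 - h i) else 0)" for i
  have h': "continuous_map K euclidean h" "h ` topspace K \<subseteq> {0..1}"
    using h(1) by (auto simp: continuous_map_in_subtopology)
  have "continuous_map K euclidean (\<lambda>i. complex_of_real (1 - h i))"
    using continuous_map_compose[OF h'(1), of euclidean "\<lambda>x. complex_of_real (1 - x)"]
    by (simp add: o_def continuous_intros)
  then have "continuous_map K euclidean b"
    by (rule continuous_map_eq) (simp add: b_def)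
  moreover have "\<forall>\<epsilon>>0. \<exists>C. compactin K C \<and> (\<forall>i\<in>topspace K - C. cmod (b i) < \<epsilon>)"
  proof (intro allI impI exI conjI ballI)
    fix \<epsilon> :: real and i assume "\<epsilon> > 0" "i \<in> topspace K - L"
    then show "cmod (b i) < \<epsilon>"
      using h(3) UL(4) by (force simp: b_def)
  qed (use UL(2) in simp)
  ultimately have "b \<in> carrier (C0 K)"
    by (auto simp: C0_def b_def)
  moreover have "cmod (b i) \<le> 1" for i
    using h'(2) unfolding b_def by (auto simp del: of_real_diff)
  ultimately show ?thesis
    using h(2) k by (intro bexI[of _ b]) (auto simp: b_def)
qed

text \<open>Multiplying by a peak function at \<open>k\<close> shows that a unit takes the value 1
  at each point, which contradicts vanishing at infinity. Hence \<open>unitalization\<close> takes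
  the branch that adjoins a unit.\<close>

lemma C0_not_unital:
  assumes K: "locally_compact_space K" "Hausdorff_space K" "\<not> compact_space K"
  shows "\<not> is_unit_of (C0 K) e"
proof
  assume e: "is_unit_of (C0 K) e"
  have e1: "e k = 1" if k: "k \<in> topspace K" for k
  proof -
    obtain b where "b \<in> carrier (C0 K)" "b k = 1"
      using C0_peak[OF K(1,2) k] by blast
    moreover from this(1) have "(\<lambda>i. e i * b i) = b"
      using e by (auto simp: is_unit_of_def)
    ultimately show ?thesis
      by (metis mult.right_neutral)
  qed
  have "e \<in> carrier (C0 K)" using e by (simp add: is_unit_of_def)
  then obtain C where C: "compactin K C" "\<And>k. k \<in> topspace K - C \<Longrightarrow> cmod (e k) < 1"
    unfolding C0_def by (auto dest!: spec[of _ 1])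
  then have "C = topspace K"
    using e1 compactin_subset_topspace[OF C(1)] by fastforce
  with C(1) K(3) show False by (simp add: compact_space_def)
qed

section \<open>The unitalization and its evaluation functionals\<close>

locale noncompact_lcH =
  fixes K :: "'k topology"
  assumes locally_compact: "locally_compact_space K" and Hausdorff: "Hausdorff_space K"
    and noncompact: "\<not> compact_space K"
begin

abbreviation A :: "(('k \<Rightarrow> complex) \<times> complex) star_algebra" where
  "A \<equiv> unitalization (C0 K)"

lemma A_fields [simp]:
  "carrier A = carrier (C0 K) \<times> UNIV"
  "a \<otimes>\<^bsub>A\<^esub> b = (\<lambda>k. fst a k * fst b k + snd a * fst b k + snd b * fst a k, snd a * snd b)"
  "a \<oplus>\<^bsub>A\<^esub> b = (\<lambda>k. fst a k + fst b k, snd a + snd b)"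
  "\<zero>\<^bsub>A\<^esub> = (\<lambda>k. 0, 0)" "\<one>\<^bsub>A\<^esub> = (\<lambda>k. 0, 1)"
  "z \<odot>\<^bsub>A\<^esub> a = (\<lambda>k. z * fst a k, z * snd a)"
  "star A a = (\<lambda>k. cnj (fst a k), cnj (snd a))"
  using C0_not_unital[OF locally_compact Hausdorff noncompact]
  by (simp_all add: unitalization_def case_prod_beta)

lemma A_closed:
  assumes "a \<in> carrier A" "b \<in> carrier A"
  shows "a \<oplus>\<^bsub>A\<^esub> b \<in> carrier A" "a \<otimes>\<^bsub>A\<^esub> b \<in> carrier A" "z \<odot>\<^bsub>A\<^esub> a \<in> carrier A"
    "star A a \<in> carrier A"
  using assms by (auto intro!: C0_closed)

lemma A_zero_one_closed: "\<zero>\<^bsub>A\<^esub> \<in> carrier A" "\<one>\<^bsub>A\<^esub> \<in> carrier A"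
  by (auto intro!: C0_zero)

lemma A_abelian_group: "abelian_group A"
proof (rule abelian_groupI)
  fix a assume a: "a \<in> carrier A"
  show "\<exists>b\<in>carrier A. b \<oplus>\<^bsub>A\<^esub> a = \<zero>\<^bsub>A\<^esub>"
    using C0_closed(3)[of "fst a" K "fst a" "-1"] a by (intro bexI[of _ "(-1) \<odot>\<^bsub>A\<^esub> a"]) auto
qed (auto intro!: C0_closed C0_zero simp: algebra_simps)

lemma A_minus:
  assumes "a \<in> carrier A" "b \<in> carrier A"
  shows "a \<ominus>\<^bsub>A\<^esub> b = (\<lambda>k. fst a k - fst b k, snd a - snd b)"
proof -
  interpret abelian_group A by (rule A_abelian_group)
  have "\<ominus>\<^bsub>A\<^esub> b = (-1) \<odot>\<^bsub>A\<^esub> b"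
    using assms C0_closed(3)[of "fst b" K "fst b" "-1"] by (intro minus_equality) auto
  then show ?thesis by (simp add: a_minus_def)
qed

text \<open>The character of the unitalization given by the point \<open>k\<close>. For
  \<open>k\<close> outside \<open>topspace K\<close> it is, on the carrier, the character at
  infinity, so it is a state for every \<open>k\<close>.\<close>

definition ev :: "'k \<Rightarrow> ('k \<Rightarrow> complex) \<times> complex \<Rightarrow> complex" where
  "ev k a = fst a k + snd a"

lemma ev_simps:
  "ev k (a \<oplus>\<^bsub>A\<^esub> b) = ev k a + ev k b" "ev k (a \<otimes>\<^bsub>A\<^esub> b) = ev k a * ev k b"
  "ev k (z \<odot>\<^bsub>A\<^esub> a) = z * ev k a" "ev k (star A a) = cnj (ev k a)"
  "ev k \<zero>\<^bsub>A\<^esub> = 0" "ev k \<one>\<^bsub>A\<^esub> = 1"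
  by (simp_all add: ev_def algebra_simps)

lemma ev_minus:
  "a \<in> carrier A \<Longrightarrow> b \<in> carrier A \<Longrightarrow> ev k (a \<ominus>\<^bsub>A\<^esub> b) = ev k a - ev k b"
  by (simp add: ev_def A_minus)

lemma A_eqI:
  assumes "\<And>k. ev k a = ev k b" "snd a = snd b"
  shows "a = b"
  using assms by (auto simp: ev_def prod_eq_iff)

lemma A_minus_eq:
  assumes "a \<in> carrier A" "b \<in> carrier A"
  shows "a \<ominus>\<^bsub>A\<^esub> b = a \<oplus>\<^bsub>A\<^esub> (-1) \<odot>\<^bsub>A\<^esub> b"
  using assms by (simp add: A_minus)

lemma A_minus_closed: "a \<in> carrier A \<Longrightarrow> b \<in> carrier A \<Longrightarrow> a \<ominus>\<^bsub>A\<^esub> b \<in> carrier A"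
  by (rule abelian_group.minus_closed[OF A_abelian_group])

lemma A_minus_self: "a \<in> carrier A \<Longrightarrow> a \<ominus>\<^bsub>A\<^esub> a = \<zero>\<^bsub>A\<^esub>"
  by (simp add: A_minus)

lemma A_minus_minus:
  assumes "a \<in> carrier A" "b \<in> carrier A" "c \<in> carrier A"
  shows "(a \<ominus>\<^bsub>A\<^esub> c) \<ominus>\<^bsub>A\<^esub> (b \<ominus>\<^bsub>A\<^esub> c) = a \<ominus>\<^bsub>A\<^esub> b"
  using assms A_minus_closed[OF assms(1,3)] A_minus_closed[OF assms(2,3)]
  by (simp add: A_minus del: A_fields)

text \<open>A multiplicative functional that respects the star sends a* a to the square of a
  modulus. The restriction is there because \<open>states\<close> consists of extensional
  functionals.\<close>

lemma ev_state: "restrict (ev k) (carrier A) \<in> states A"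
proof -
  have "ev k (star A a \<otimes>\<^bsub>A\<^esub> a) \<in> \<real>\<^sub>\<ge>\<^sub>0" for a
    by (simp add: ev_simps(2,4) complex_norm_square[symmetric] mult.commute del: A_fields)
  then show ?thesis
    by (auto simp: states_def ev_simps A_closed A_zero_one_closed simp del: A_fields)
qed

text \<open>A character passes through the finite sum and both products in each term, so the frame
  sum becomes a scalar sum at \<open>k\<close>.\<close>

lemma ev_frame_sum:
  assumes xs: "xs \<in> J \<rightarrow> carrier (C0 K)" and x: "x \<in> carrier (C0 K)" and F: "finite F" "F \<subseteq> J"
  shows "frame_sum A (self_module (C0 K)) xs x F \<in> carrier A"
    and "ev k (frame_sum A (self_module (C0 K)) xs x F) =
      complex_of_real (\<Sum>j\<in>F. (cmod (x k))\<^sup>2 * (cmod (xs j k))\<^sup>2)"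
proof -
  interpret abelian_group A by (rule A_abelian_group)
  let ?t = "\<lambda>j. ip (self_module (C0 K)) x (xs j) \<otimes>\<^bsub>A\<^esub> ip (self_module (C0 K)) (xs j) x"
  have t: "?t j \<in> carrier A" if "j \<in> J" for j
    using xs x that by (auto simp: self_module_def intro!: C0_closed)
  have evt: "ev k (?t j) = complex_of_real ((cmod (x k))\<^sup>2 * (cmod (xs j k))\<^sup>2)" for j
    by (simp add: self_module_def ev_def complex_norm_square of_real_mult algebra_simps
        del: of_real_power)
  show "frame_sum A (self_module (C0 K)) xs x F \<in> carrier A"
    unfolding frame_sum_def using t F by (intro finsum_closed) auto
  show "ev k (frame_sum A (self_module (C0 K)) xs x F) =
      complex_of_real (\<Sum>j\<in>F. (cmod (x k))\<^sup>2 * (cmod (xs j k))\<^sup>2)"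
    unfolding frame_sum_def using F
  proof (induction F)
    case empty
    then show ?case by (simp add: ev_def)
  next
    case (insert j F)
    have "finsum A ?t (insert j F) = ?t j \<oplus>\<^bsub>A\<^esub> finsum A ?t F"
      using insert t by (intro finsum_insert) auto
    then show ?case
      using insert by (simp add: ev_simps(1) evt del: A_fields)
  qed
qed

lemma ev_ip:
  "ev k (z \<odot>\<^bsub>A\<^esub> ip (self_module (C0 K)) x x) = z * complex_of_real ((cmod (x k))\<^sup>2)"
  by (simp add: self_module_def ev_def complex_norm_square mult.commute del: of_real_power)

text \<open>The common end of both frame cases: since x(k) = 1, the evaluated partial sums are those
  of |x_j(k)|^2, and the lower frame bound keeps their limit at or above \<open>c\<close>.\<close>

lemma frame_pointwise_limit:
  assumes xs: "xs \<in> J \<rightarrow> carrier (C0 K)" and x: "x \<in> carrier (C0 K)" "x k = 1"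
    and lim: "((\<lambda>F. ev k (frame_sum A (self_module (C0 K)) xs x F)) \<longlongrightarrow> l) (finite_subsets_at_top J)"
    and c: "c > 0" "l - complex_of_real c \<in> \<real>\<^sub>\<ge>\<^sub>0"
  shows "\<exists>L>0. ((\<lambda>j. (cmod (xs j k))\<^sup>2) has_sum L) J"
proof -
  have "((\<lambda>F. Re (ev k (frame_sum A (self_module (C0 K)) xs x F))) \<longlongrightarrow> Re l)
      (finite_subsets_at_top J)"
    using lim by (rule tendsto_Re)
  moreover have "\<forall>\<^sub>F F in finite_subsets_at_top J.
      Re (ev k (frame_sum A (self_module (C0 K)) xs x F)) = (\<Sum>j\<in>F. (cmod (xs j k))\<^sup>2)"
    using ev_frame_sum(2)[OF xs x(1)] x(2)
    by (intro eventually_finite_subsets_at_top_weakI) simp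
  ultimately have "((\<lambda>j. (cmod (xs j k))\<^sup>2) has_sum Re l) J"
    unfolding has_sum_def by (rule Lim_transform_eventually)
  moreover have "Re l > 0"
    using c by (auto simp: complex_nonneg_Reals_iff)
  ultimately show ?thesis by blast
qed

text \<open>\<open>anorm\<close> is an operator norm on the unit ball of \<open>C0 K\<close>. A peak
  function \<open>b\<close> at \<open>k\<close> lies in this ball, and the product with
  \<open>b\<close> has value \<open>ev k a\<close> at \<open>k\<close>.\<close>

lemma ev_le_anorm:
  assumes a: "a \<in> carrier A" and k: "k \<in> topspace K"
  shows "cmod (ev k a) \<le> anorm A a"
proof -
  let ?n = "\<lambda>b. SUP i. cmod (fst a i * b i + snd a * b i)"
  let ?S = "{b \<in> carrier (C0 K). (SUP i. cmod (b i)) \<le> 1}"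
  obtain B where B: "B \<ge> 0" "\<And>i. cmod (fst a i) \<le> B"
    using C0_bounded a by fastforce
  have anorm: "anorm A a = (SUP b\<in>?S. ?n b)"
    by (simp add: unitalization_def case_prod_beta)
  \<comment> \<open>A bound uniform in \<open>b\<close> and \<open>i\<close>: a real supremum
    dominates its members only for sets bounded above.\<close>
  have bd: "cmod (fst a i * b i + snd a * b i) \<le> B + cmod (snd a)" if bS: "b \<in> ?S" for b i
  proof -
    obtain D where "\<And>i. cmod (b i) \<le> D"
      using C0_bounded[of b K] bS by blast
    then have "bdd_above (range (\<lambda>i. cmod (b i)))"
      by (intro bdd_aboveI2) auto
    then have "cmod (b i) \<le> 1"
      using bS cSUP_upper2[of "\<lambda>i. cmod (b i)" UNIV i "cmod (b i)"] by auto
    moreover have "cmod (fst a i + snd a) \<le> B + cmod (snd a)"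
      using B(2)[of i] norm_triangle_ineq[of "fst a i" "snd a"] by linarith
    ultimately have "cmod (fst a i + snd a) * cmod (b i) \<le> (B + cmod (snd a)) * 1"
      using B(1) by (intro mult_mono) auto
    then show ?thesis
      by (simp add: norm_mult[symmetric] algebra_simps)
  qed
  obtain b where b: "b \<in> carrier (C0 K)" "b k = 1" "\<And>i. cmod (b i) \<le> 1"
    using C0_peak[OF locally_compact Hausdorff k] by blast
  then have bS: "b \<in> ?S"
    by (auto intro: cSUP_least)
  have "cmod (ev k a) = cmod (fst a k * b k + snd a * b k)"
    by (simp add: ev_def b(2))
  also have "\<dots> \<le> ?n b"
    using bd[OF bS] by (intro cSUP_upper bdd_aboveI2) auto
  also have "\<dots> \<le> (SUP b\<in>?S. ?n b)"
    using bS bd by (intro cSUP_upper bdd_aboveI2[where M = "B + cmod (snd a)"] cSUP_least) auto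
  finally show ?thesis by (simp add: anorm)
qed

text \<open>Evaluation is contractive, so norm convergence passes to the point \<open>k\<close>. The
  order relation provides \<open>d\<close> with s - c<x,x> = d* d, which evaluates to |ev k
  d|^2.\<close>

lemma standard_frame_pointwise:
  assumes "standard_frame A (self_module (C0 K)) J xs" and k: "k \<in> topspace K"
  shows "xs \<in> J \<rightarrow> carrier (C0 K) \<and> (\<exists>L>0. ((\<lambda>j. (cmod (xs j k))\<^sup>2) has_sum L) J)"
proof -
  have carr: "carrier (self_module (C0 K)) = carrier (C0 K)"
    by (simp add: self_module_def)
  obtain x where x: "x \<in> carrier (C0 K)" "x k = 1"
    using C0_peak[OF locally_compact Hausdorff k] by blast
  let ?s = "frame_sum A (self_module (C0 K)) xs x"
  obtain c s where xs: "xs \<in> J \<rightarrow> carrier (C0 K)" and c: "c > 0" and s: "s \<in> carrier A"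
      and lim: "((\<lambda>F. anorm A (?s F \<ominus>\<^bsub>A\<^esub> s)) \<longlongrightarrow> 0) (finite_subsets_at_top J)"
      and le: "alg_le A (complex_of_real c \<odot>\<^bsub>A\<^esub> ip (self_module (C0 K)) x x) s"
    using assms(1) x(1) unfolding standard_frame_def carr by blast
  have "\<forall>\<^sub>F F in finite_subsets_at_top J. norm (ev k (?s F) - ev k s) \<le> anorm A (?s F \<ominus>\<^bsub>A\<^esub> s)"
  proof (intro eventually_finite_subsets_at_top_weakI)
    fix F assume F: "finite F" "F \<subseteq> J"
    have sF: "?s F \<in> carrier A"
      by (rule ev_frame_sum(1)[OF xs x(1) F])
    then have "?s F \<ominus>\<^bsub>A\<^esub> s \<in> carrier A"
      by (intro abelian_group.minus_closed[OF A_abelian_group] s)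
    then have "cmod (ev k (?s F \<ominus>\<^bsub>A\<^esub> s)) \<le> anorm A (?s F \<ominus>\<^bsub>A\<^esub> s)"
      by (rule ev_le_anorm[OF _ k])
    then show "norm (ev k (?s F) - ev k s) \<le> anorm A (?s F \<ominus>\<^bsub>A\<^esub> s)"
      by (simp only: ev_minus[OF sF s])
  qed
  then have "((\<lambda>F. ev k (?s F) - ev k s) \<longlongrightarrow> 0) (finite_subsets_at_top J)"
    using lim by (rule Lim_null_comparison)
  then have "((\<lambda>F. ev k (?s F)) \<longlongrightarrow> ev k s) (finite_subsets_at_top J)"
    by (simp add: LIM_zero_iff)
  moreover obtain d where "s \<ominus>\<^bsub>A\<^esub> complex_of_real c \<odot>\<^bsub>A\<^esub> ip (self_module (C0 K)) x x = star A d \<otimes>\<^bsub>A\<^esub> d"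
      "complex_of_real c \<odot>\<^bsub>A\<^esub> ip (self_module (C0 K)) x x \<in> carrier A"
    using le unfolding alg_le_def by blast
  then have "ev k s - ev k (complex_of_real c \<odot>\<^bsub>A\<^esub> ip (self_module (C0 K)) x x) =
      cnj (ev k d) * ev k d"
    using ev_minus[OF s] by (metis ev_simps(2,4))
  then have "ev k s - complex_of_real c \<in> \<real>\<^sub>\<ge>\<^sub>0"
    by (simp add: ev_ip x(2) complex_norm_square[symmetric] mult.commute del: A_fields)
  ultimately show ?thesis
    using frame_pointwise_limit[OF xs x] c xs by blast
qed

end

section \<open>GNS representations\<close>

locale gns_state = noncompact_lcH K for K :: "'k topology" +
  fixes \<phi> :: "('k \<Rightarrow> complex) \<times> complex \<Rightarrow> complex"
  assumes state: "\<phi> \<in> states A"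
begin

abbreviation V where "V \<equiv> gns_pre A \<phi>"

definition s where "s a b = \<phi> (star A a \<otimes>\<^bsub>A\<^esub> b)"

text \<open>The square of the GNS seminorm; most estimates are made for it, without square
  roots.\<close>

definition q :: "('k \<Rightarrow> complex) \<times> complex \<Rightarrow> real" where "q a = Re (s a a)"

lemma V_fields [simp]:
  "carrier V = carrier A" "\<zero>\<^bsub>V\<^esub> = \<zero>\<^bsub>A\<^esub>" "a \<oplus>\<^bsub>V\<^esub> b = a \<oplus>\<^bsub>A\<^esub> b" "z \<odot>\<^bsub>V\<^esub> a = z \<odot>\<^bsub>A\<^esub> a"
  "ip V a b = s a b" "a \<ominus>\<^bsub>V\<^esub> b = a \<ominus>\<^bsub>A\<^esub> b"
  by (simp_all add: gns_pre_def s_def a_minus_def a_inv_def m_inv_def del: A_fields)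

lemma hnorm_V [simp]: "hnorm V a = sqrt (q a)"
  by (simp add: hnorm_def q_def)

section \<open>The GNS form and its Cauchy-Schwarz type estimates\<close>

lemma state_add: "x \<in> carrier A \<Longrightarrow> y \<in> carrier A \<Longrightarrow> \<phi> (x \<oplus>\<^bsub>A\<^esub> y) = \<phi> x + \<phi> y"
  using state unfolding states_def by blast

lemma state_smult: "x \<in> carrier A \<Longrightarrow> \<phi> (z \<odot>\<^bsub>A\<^esub> x) = z * \<phi> x"
  using state unfolding states_def by blast

lemma s_add:
  assumes "a \<in> carrier A" "b \<in> carrier A" "c \<in> carrier A"
  shows "s a (b \<oplus>\<^bsub>A\<^esub> c) = s a b + s a c" "s (b \<oplus>\<^bsub>A\<^esub> c) a = s b a + s c a"
proof -
  have "star A a \<otimes>\<^bsub>A\<^esub> (b \<oplus>\<^bsub>A\<^esub> c) = star A a \<otimes>\<^bsub>A\<^esub> b \<oplus>\<^bsub>A\<^esub> star A a \<otimes>\<^bsub>A\<^esub> c"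
    "star A (b \<oplus>\<^bsub>A\<^esub> c) \<otimes>\<^bsub>A\<^esub> a = star A b \<otimes>\<^bsub>A\<^esub> a \<oplus>\<^bsub>A\<^esub> star A c \<otimes>\<^bsub>A\<^esub> a"
    by (auto simp: fun_eq_iff algebra_simps)
  then show "s a (b \<oplus>\<^bsub>A\<^esub> c) = s a b + s a c" "s (b \<oplus>\<^bsub>A\<^esub> c) a = s b a + s c a"
    unfolding s_def using assms by (simp_all add: state_add A_closed del: A_fields)
qed

lemma s_smult:
  assumes "a \<in> carrier A" "b \<in> carrier A"
  shows "s a (z \<odot>\<^bsub>A\<^esub> b) = z * s a b" "s (z \<odot>\<^bsub>A\<^esub> a) b = cnj z * s a b"
proof -
  have "star A a \<otimes>\<^bsub>A\<^esub> (z \<odot>\<^bsub>A\<^esub> b) = z \<odot>\<^bsub>A\<^esub> (star A a \<otimes>\<^bsub>A\<^esub> b)"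
    "star A (z \<odot>\<^bsub>A\<^esub> a) \<otimes>\<^bsub>A\<^esub> b = cnj z \<odot>\<^bsub>A\<^esub> (star A a \<otimes>\<^bsub>A\<^esub> b)"
    by (auto simp: fun_eq_iff algebra_simps)
  then show "s a (z \<odot>\<^bsub>A\<^esub> b) = z * s a b" "s (z \<odot>\<^bsub>A\<^esub> a) b = cnj z * s a b"
    unfolding s_def using assms by (simp_all add: state_smult A_closed del: A_fields)
qed

lemma s_minus:
  assumes "a \<in> carrier A" "b \<in> carrier A" "c \<in> carrier A"
  shows "s a (b \<ominus>\<^bsub>A\<^esub> c) = s a b - s a c" "s (b \<ominus>\<^bsub>A\<^esub> c) a = s b a - s c a"
  using assms by (simp_all add: A_minus_eq s_add s_smult A_closed del: A_fields)

lemma s_self: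
  assumes "a \<in> carrier A"
  shows "s a a = complex_of_real (q a)" "q a \<ge> 0"
proof -
  have "s a a \<in> \<real>\<^sub>\<ge>\<^sub>0"
    using state assms unfolding states_def s_def by blast
  then show "s a a = complex_of_real (q a)" "q a \<ge> 0"
    by (auto simp: q_def complex_nonneg_Reals_iff complex_eq_iff)
qed

lemma s_zero: "s \<zero>\<^bsub>A\<^esub> \<zero>\<^bsub>A\<^esub> = 0"
  using s_smult(1)[OF A_zero_one_closed(1) A_zero_one_closed(1), of 0] by simp

lemma q_expand:
  assumes a: "a \<in> carrier A" and b: "b \<in> carrier A"
  shows "complex_of_real (q (a \<oplus>\<^bsub>A\<^esub> z \<odot>\<^bsub>A\<^esub> b)) =
    complex_of_real (q a + (cmod z)\<^sup>2 * q b) + z * s a b + cnj z * s b a"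
proof -
  have "complex_of_real (q (a \<oplus>\<^bsub>A\<^esub> z \<odot>\<^bsub>A\<^esub> b)) = s (a \<oplus>\<^bsub>A\<^esub> z \<odot>\<^bsub>A\<^esub> b) (a \<oplus>\<^bsub>A\<^esub> z \<odot>\<^bsub>A\<^esub> b)"
    using a b by (intro s_self(1)[symmetric] A_closed)
  also have "\<dots> = s a a + z * s a b + cnj z * s b a + z * cnj z * s b b"
    using a b by (simp add: s_add s_smult A_closed algebra_simps del: A_fields)
  finally show ?thesis
    using a b by (simp add: s_self(1) complex_norm_square[symmetric])
qed

text \<open>Since the form is real on the diagonal, the cross terms in the expansion are real for z
  = 1 and z = \<i>; this fixes imaginary and real part.\<close>

lemma s_hermitian:
  assumes a: "a \<in> carrier A" and b: "b \<in> carrier A"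
  shows "s b a = cnj (s a b)"
proof -
  have "Im (s a b + s b a) = 0"
    using arg_cong[OF q_expand[OF a b, of 1], of Im] by simp
  moreover have "Im (\<i> * s a b - \<i> * s b a) = 0"
    using arg_cong[OF q_expand[OF a b, of \<i>], of Im] by simp
  ultimately show ?thesis by (simp add: complex_eq_iff)
qed

text \<open>Positivity of q(a + zb) at z = 1, -1, \<i>, -\<i> bounds the real and the imaginary part
  by half the right-hand side each.\<close>

lemma s_bound:
  assumes a: "a \<in> carrier A" and b: "b \<in> carrier A"
  shows "cmod (s a b) \<le> q a + q b"
proof -
  have *: "0 \<le> q a + (cmod z)\<^sup>2 * q b + 2 * Re (z * s a b)" for z
  proof -
    have "q (a \<oplus>\<^bsub>A\<^esub> z \<odot>\<^bsub>A\<^esub> b) = q a + (cmod z)\<^sup>2 * q b + 2 * Re (z * s a b)"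
      using arg_cong[OF q_expand[OF a b, of z], of Re] s_hermitian[OF a b] by simp
    moreover have "q (a \<oplus>\<^bsub>A\<^esub> z \<odot>\<^bsub>A\<^esub> b) \<ge> 0"
      using a b by (intro s_self(2) A_closed)
    ultimately show ?thesis by linarith
  qed
  have "2 * \<bar>Re (s a b)\<bar> \<le> q a + q b" "2 * \<bar>Im (s a b)\<bar> \<le> q a + q b"
    using *[of 1] *[of "-1"] *[of \<i>] *[of "-\<i>"] by auto
  with cmod_le[of "s a b"] show ?thesis by linarith
qed

text \<open>\<open>s_bound\<close> for \<open>a\<close> times sqrt t and \<open>b\<close> divided by
  sqrt t. The free parameter makes it a substitute for Cauchy-Schwarz.\<close>

lemma s_bound_scaled:
  assumes a: "a \<in> carrier A" and b: "b \<in> carrier A" and t: "t > 0"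
  shows "cmod (s a b) \<le> t * q a + q b / t"
proof -
  let ?r = "complex_of_real (sqrt t)"
  have q_smult: "q (z \<odot>\<^bsub>A\<^esub> c) = (cmod z)\<^sup>2 * q c" if c: "c \<in> carrier A" for z c
  proof -
    have "s (z \<odot>\<^bsub>A\<^esub> c) (z \<odot>\<^bsub>A\<^esub> c) = cnj z * z * s c c"
      using c by (simp add: s_smult A_closed del: A_fields)
    also have "\<dots> = complex_of_real ((cmod z)\<^sup>2 * q c)"
      by (simp add: s_self(1)[OF c] complex_norm_square mult.commute del: of_real_power)
    finally show ?thesis by (simp add: q_def)
  qed
  have "s (?r \<odot>\<^bsub>A\<^esub> a) (inverse ?r \<odot>\<^bsub>A\<^esub> b) = s a b"
    using a b t by (simp add: s_smult A_closed del: A_fields)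
  moreover have "cmod (s (?r \<odot>\<^bsub>A\<^esub> a) (inverse ?r \<odot>\<^bsub>A\<^esub> b)) \<le>
      q (?r \<odot>\<^bsub>A\<^esub> a) + q (inverse ?r \<odot>\<^bsub>A\<^esub> b)"
    using a b by (intro s_bound A_closed)
  moreover have "(cmod ?r)\<^sup>2 = t" "(cmod (inverse ?r))\<^sup>2 = inverse t"
    using t by (simp_all add: norm_inverse power_inverse)
  then have "q (?r \<odot>\<^bsub>A\<^esub> a) = t * q a" "q (inverse ?r \<odot>\<^bsub>A\<^esub> b) = q b / t"
    by (simp_all only: q_smult[OF a] q_smult[OF b] divide_inverse mult.commute)
  ultimately show ?thesis by simp
qed

text \<open>The parallelogram law with the nonnegative term q(a + b) dropped; it stands in for the
  triangle inequality.\<close>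

lemma q_minus_le:
  assumes a: "a \<in> carrier A" and b: "b \<in> carrier A"
  shows "q (a \<ominus>\<^bsub>A\<^esub> b) \<le> 2 * q a + 2 * q b"
proof -
  have "q (a \<ominus>\<^bsub>A\<^esub> b) = q a + q b - 2 * Re (s a b)"
    using s_hermitian[OF a b] a b
    by (simp add: q_def s_minus A_minus_closed del: A_fields)
  moreover have "0 \<le> q (a \<oplus>\<^bsub>A\<^esub> 1 \<odot>\<^bsub>A\<^esub> b)"
    using a b by (intro s_self(2) A_closed)
  then have "2 * Re (s a b) \<ge> - (q a + q b)"
    using arg_cong[OF q_expand[OF a b, of 1], of Re] s_hermitian[OF a b]
    by (simp del: A_fields)
  ultimately show ?thesis by linarith
qed

text \<open>Left multiplication by \<open>a\<close> is bounded because \<open>M\<^sup>2 - a\<^sup>* a = d\<^sup>* d\<close> for \<open>d\<close> the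
  pointwise square root, which lies in the unitalization.\<close>

lemma q_mult_le:
  assumes a: "a \<in> carrier A"
  shows "\<exists>M\<ge>0. \<forall>b\<in>carrier A. q (a \<otimes>\<^bsub>A\<^esub> b) \<le> M * q b"
proof -
  obtain f c where fc: "a = (f, c)" "f \<in> carrier (C0 K)"
    using a by auto
  obtain B where B: "B \<ge> 0" "\<And>k. cmod (f k) \<le> B"
    using C0_bounded[OF fc(2)] by blast
  \<comment> \<open>\<open>M\<close> dominates |a| at every point and also its value |c| at
    infinity, so both roots below have nonnegative radicands.\<close>
  define M where "M = B + cmod c"
  have M: "cmod (f k + c) \<le> M" for k
    using B(2)[of k] norm_triangle_ineq[of "f k" c] by (simp add: M_def)
  have cM: "cmod c \<le> M" using B(1) by (simp add: M_def)
  let ?R = "\<lambda>w. complex_of_real (sqrt (M\<^sup>2 - (cmod w)\<^sup>2))"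
  have R: "cnj (?R w) * ?R w = complex_of_real (M\<^sup>2) - cnj w * w" if w: "cmod w \<le> M" for w
  proof -
    have "(cmod w)\<^sup>2 \<le> M\<^sup>2"
      using w by (intro power_mono) auto
    then have "cnj (?R w) * ?R w = complex_of_real (M\<^sup>2 - (cmod w)\<^sup>2)"
      by (simp only: complex_cnj_complex_of_real of_real_mult[symmetric] real_sqrt_mult_self) simp
    also have "\<dots> = complex_of_real (M\<^sup>2) - cnj w * w"
      by (simp only: of_real_diff complex_norm_square mult.commute)
    finally show ?thesis .
  qed
  \<comment> \<open>The scalar part is the limit of the root at infinity. Subtracting it leaves a
    continuous function of \<open>f\<close> that is 0 at 0, hence an element of
    \<open>C0 K\<close>.\<close>
  define d where "d = (\<lambda>k. ?R (f k + c) - ?R c, ?R c)"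
  have d: "d \<in> carrier A"
    using C0_image[OF fc(2), of "\<lambda>z. ?R (z + c) - ?R c"] by (simp add: d_def continuous_intros)
  have evd: "cnj (ev k d) * ev k d = complex_of_real (M\<^sup>2) - cnj (ev k a) * ev k a" for k
    using R[OF M[of k]] by (simp add: ev_def d_def fc(1))
  have sndd: "cnj (snd d) * snd d = complex_of_real (M\<^sup>2) - cnj (snd a) * snd a"
    using R[OF cM] by (simp add: d_def fc(1))
  have "q (a \<otimes>\<^bsub>A\<^esub> b) \<le> M\<^sup>2 * q b" if b: "b \<in> carrier A" for b
  proof -
    have alg: "cnj (x * z) * (x * z) + cnj (y * z) * (y * z) = m * (cnj z * z)"
      if "cnj y * y = m - cnj x * x" for x y z m :: complex
    proof -
      have "cnj (x * z) * (x * z) + cnj (y * z) * (y * z) = (cnj x * x + cnj y * y) * (cnj z * z)"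
        by (simp add: algebra_simps)
      with that show ?thesis by simp
    qed
    have "star A (a \<otimes>\<^bsub>A\<^esub> b) \<otimes>\<^bsub>A\<^esub> (a \<otimes>\<^bsub>A\<^esub> b) \<oplus>\<^bsub>A\<^esub> star A (d \<otimes>\<^bsub>A\<^esub> b) \<otimes>\<^bsub>A\<^esub> (d \<otimes>\<^bsub>A\<^esub> b) =
        complex_of_real (M\<^sup>2) \<odot>\<^bsub>A\<^esub> (star A b \<otimes>\<^bsub>A\<^esub> b)" (is "?l = ?r")
    proof (rule A_eqI)
      show "ev k ?l = ev k ?r" for k
        by (simp only: ev_simps) (rule alg[OF evd])
      show "snd ?l = snd ?r"
        using alg[OF sndd, of "snd b"] by simp
    qed
    then have "s (a \<otimes>\<^bsub>A\<^esub> b) (a \<otimes>\<^bsub>A\<^esub> b) + s (d \<otimes>\<^bsub>A\<^esub> b) (d \<otimes>\<^bsub>A\<^esub> b) = complex_of_real (M\<^sup>2) * s b b"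
      unfolding s_def using a b d
      by (simp add: state_add[symmetric] state_smult[symmetric] A_closed del: A_fields)
    then have "Re (s (a \<otimes>\<^bsub>A\<^esub> b) (a \<otimes>\<^bsub>A\<^esub> b) + s (d \<otimes>\<^bsub>A\<^esub> b) (d \<otimes>\<^bsub>A\<^esub> b)) = Re (complex_of_real (M\<^sup>2) * s b b)"
      by (rule arg_cong)
    then have "q (a \<otimes>\<^bsub>A\<^esub> b) + q (d \<otimes>\<^bsub>A\<^esub> b) = M\<^sup>2 * q b"
      by (simp add: q_def del: A_fields of_real_power)
    moreover have "q (d \<otimes>\<^bsub>A\<^esub> b) \<ge> 0"
      using b d by (intro s_self(2) A_closed)
    ultimately show ?thesis by linarith
  qed
  then show ?thesis
    by (intro exI[of _ "M\<^sup>2"]) simp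
qed

section \<open>Convergence in the GNS seminorm\<close>

lemma s_tendsto_zero:
  assumes u: "\<And>n. u n \<in> carrier A" and b: "b \<in> carrier A" and q: "(\<lambda>n. q (u n)) \<longlonglongrightarrow> 0"
  shows "(\<lambda>n. s b (u n)) \<longlonglongrightarrow> 0"
proof (rule Lim_null_comparison)
  \<comment> \<open>The scale in \<open>s_bound_scaled\<close>: it tends to 0, yet dominates sqrt (q
    (u n)), so both terms of the bound vanish. The summand 1/(n+1) keeps it positive when q (u n) =
    0.\<close>
  let ?t = "\<lambda>n::nat. sqrt (q (u n)) + inverse (real (Suc n))"
  show "\<forall>\<^sub>F n in sequentially. norm (s b (u n)) \<le> ?t n * q b + sqrt (q (u n))"
  proof (intro always_eventually allI)
    fix n
    have q0: "q (u n) \<ge> 0" using u by (rule s_self(2))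
    then have t: "?t n > 0" by (simp add: add_nonneg_pos)
    have "q (u n) = sqrt (q (u n)) * sqrt (q (u n))" using q0 by simp
    also have "\<dots> \<le> sqrt (q (u n)) * ?t n"
      using q0 by (intro mult_left_mono) auto
    finally have "q (u n) / ?t n \<le> sqrt (q (u n))"
      using t by (simp add: pos_divide_le_eq)
    with s_bound_scaled[OF b u t, of n] show "norm (s b (u n)) \<le> ?t n * q b + sqrt (q (u n))"
      by linarith
  qed
  have "?t \<longlonglongrightarrow> sqrt 0 + 0"
    by (rule tendsto_add[OF tendsto_real_sqrt[OF q] LIMSEQ_inverse_real_of_nat])
  then have "(\<lambda>n. ?t n * q b + sqrt (q (u n))) \<longlonglongrightarrow> (sqrt 0 + 0) * q b + sqrt 0"
    by (rule tendsto_add[OF tendsto_mult[OF _ tendsto_const] tendsto_real_sqrt[OF q]])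
  then show "(\<lambda>n. ?t n * q b + sqrt (q (u n))) \<longlonglongrightarrow> 0" by simp
qed

text \<open>Says that \<open>u\<close> represents the image of \<open>v\<close> in the completion.
  Operations there work on arbitrarily chosen representatives, so this property is tracked instead
  of a particular sequence.\<close>

definition converges :: "(nat \<Rightarrow> ('k \<Rightarrow> complex) \<times> complex) \<Rightarrow> ('k \<Rightarrow> complex) \<times> complex \<Rightarrow> bool" where
  "converges u v \<longleftrightarrow> range u \<subseteq> carrier A \<and> v \<in> carrier A \<and> (\<lambda>n. q (u n \<ominus>\<^bsub>A\<^esub> v)) \<longlonglongrightarrow> 0"

lemma convergesD:
  assumes "converges u v"
  shows "u n \<in> carrier A" "v \<in> carrier A" "u n \<ominus>\<^bsub>A\<^esub> v \<in> carrier A" "(\<lambda>n. q (u n \<ominus>\<^bsub>A\<^esub> v)) \<longlonglongrightarrow> 0"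
proof -
  show "u n \<in> carrier A" "v \<in> carrier A" "(\<lambda>n. q (u n \<ominus>\<^bsub>A\<^esub> v)) \<longlonglongrightarrow> 0"
    using assms unfolding converges_def by blast+
  then show "u n \<ominus>\<^bsub>A\<^esub> v \<in> carrier A" by (intro A_minus_closed)
qed

lemma q_zero: "q \<zero>\<^bsub>A\<^esub> = 0"
  by (simp add: q_def s_zero del: A_fields)

lemma converges_const: "v \<in> carrier A \<Longrightarrow> converges (\<lambda>n. v) v"
  by (simp add: converges_def A_minus_self q_zero del: A_fields)

lemma converges_ip:
  assumes u: "converges u v" and w: "converges w x"
  shows "(\<lambda>n. s (u n) (w n)) \<longlonglongrightarrow> s v x"
proof -
  note u = convergesD[OF u] and w = convergesD[OF w]
  let ?u = "\<lambda>n. u n \<ominus>\<^bsub>A\<^esub> v" and ?w = "\<lambda>n. w n \<ominus>\<^bsub>A\<^esub> x"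
  have split: "s (u n) (w n) = s (?u n) (?w n) + cnj (s x (?u n)) + s v (?w n) + s v x" for n
    using u w s_hermitian[OF u(3)[of n] w(2)]
    by (simp add: s_hermitian[OF w(2) u(3)] s_minus del: A_fields)
  have "(\<lambda>n. s (?u n) (?w n)) \<longlonglongrightarrow> 0"
  proof (rule Lim_null_comparison)
    show "\<forall>\<^sub>F n in sequentially. norm (s (?u n) (?w n)) \<le> q (?u n) + q (?w n)"
      using s_bound[OF u(3) w(3)] by simp
    show "(\<lambda>n. q (?u n) + q (?w n)) \<longlonglongrightarrow> 0"
      using tendsto_add[OF u(4) w(4)] by simp
  qed
  moreover have "(\<lambda>n. cnj (s x (?u n))) \<longlonglongrightarrow> cnj 0"
    by (intro tendsto_cnj s_tendsto_zero u w)
  moreover have "(\<lambda>n. s v (?w n)) \<longlonglongrightarrow> 0"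
    by (intro s_tendsto_zero u w)
  ultimately have "(\<lambda>n. s (?u n) (?w n) + cnj (s x (?u n)) + s v (?w n) + s v x) \<longlonglongrightarrow> 0 + cnj 0 + 0 + s v x"
    by (intro tendsto_add tendsto_const)
  then show ?thesis by (simp add: split)
qed

lemma converges_cauchy:
  assumes u: "converges u v"
  shows "u \<in> cauchy_seqs V"
proof -
  note D = convergesD[OF u]
  have "\<exists>N. \<forall>m\<ge>N. \<forall>n\<ge>N. sqrt (q (u m \<ominus>\<^bsub>A\<^esub> u n)) < \<epsilon>" if \<epsilon>: "\<epsilon> > 0" for \<epsilon>
  proof -
    \<comment> \<open>The factor 1/4 absorbs the two factors 2 of \<open>q_minus_le\<close>.\<close>
    have "\<forall>\<^sub>F n in sequentially. q (u n \<ominus>\<^bsub>A\<^esub> v) < \<epsilon>\<^sup>2 / 4"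
      using \<epsilon> by (intro order_tendstoD(2)[OF D(4)]) simp
    then obtain N where N: "\<And>n. n \<ge> N \<Longrightarrow> q (u n \<ominus>\<^bsub>A\<^esub> v) < \<epsilon>\<^sup>2 / 4"
      by (auto simp: eventually_sequentially)
    have "sqrt (q (u m \<ominus>\<^bsub>A\<^esub> u n)) < \<epsilon>" if "m \<ge> N" "n \<ge> N" for m n
    proof -
      have "q (u m \<ominus>\<^bsub>A\<^esub> u n) \<le> 2 * q (u m \<ominus>\<^bsub>A\<^esub> v) + 2 * q (u n \<ominus>\<^bsub>A\<^esub> v)"
        using q_minus_le[OF D(3) D(3), of m n] by (simp add: A_minus_minus D del: A_fields)
      also have "\<dots> < \<epsilon>\<^sup>2"
        using N[OF that(1)] N[OF that(2)] by simp
      finally show ?thesis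
        using \<epsilon> by (simp add: real_less_lsqrt)
    qed
    then show ?thesis by blast
  qed
  moreover have "range u \<subseteq> carrier A" using u by (simp add: converges_def)
  ultimately show ?thesis
    by (simp add: cauchy_seqs_def del: A_fields)
qed

text \<open>The chosen representative differs from \<open>u\<close> by a null sequence, so it has
  the same limit \<open>v\<close>. This makes the choice in \<open>class_rep\<close>
  harmless.\<close>

lemma class_rep_converges:
  assumes u: "converges u v"
  shows "converges (class_rep (cauchy_class V u)) v"
proof -
  note D = convergesD[OF u]
  define r where "r = class_rep (cauchy_class V u)"
  \<comment> \<open>Reflexivity shows that the class is nonempty, so that the choice operator
    returns a member of it.\<close>
  have "u \<in> cauchy_class V u"
    using converges_cauchy[OF u]
    by (simp add: cauchy_class_def cauchy_rel_def A_minus_self D q_zero del: A_fields)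
  then have "r \<in> cauchy_class V u"
    unfolding class_rep_def r_def by (rule someI[of "\<lambda>t. t \<in> cauchy_class V u"])
  then have r: "r \<in> cauchy_seqs V" "(\<lambda>n. sqrt (q (u n \<ominus>\<^bsub>A\<^esub> r n))) \<longlonglongrightarrow> 0"
    by (simp_all add: cauchy_class_def cauchy_rel_def del: A_fields)
  then have rA: "r n \<in> carrier A" for n
    by (auto simp: cauchy_seqs_def simp del: A_fields)
  have "(\<lambda>n. (sqrt (q (u n \<ominus>\<^bsub>A\<^esub> r n)))\<^sup>2) \<longlonglongrightarrow> 0\<^sup>2"
    using r(2) by (rule tendsto_power)
  then have ur: "(\<lambda>n. q (u n \<ominus>\<^bsub>A\<^esub> r n)) \<longlonglongrightarrow> 0"
    by (simp add: s_self(2) A_minus_closed D rA del: A_fields)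
  have "(\<lambda>n. q (r n \<ominus>\<^bsub>A\<^esub> v)) \<longlonglongrightarrow> 0"
  proof (rule Lim_null_comparison)
    show "\<forall>\<^sub>F n in sequentially. norm (q (r n \<ominus>\<^bsub>A\<^esub> v)) \<le> 2 * q (u n \<ominus>\<^bsub>A\<^esub> v) + 2 * q (u n \<ominus>\<^bsub>A\<^esub> r n)"
    proof (intro always_eventually allI)
      fix n
      have "r n \<ominus>\<^bsub>A\<^esub> v = (u n \<ominus>\<^bsub>A\<^esub> v) \<ominus>\<^bsub>A\<^esub> (u n \<ominus>\<^bsub>A\<^esub> r n)"
        using rA[of n] D(1)[of n] D(2) D(3)[of n] A_minus_closed[OF D(1) rA, of n n]
        by (simp add: A_minus del: A_fields)
      then show "norm (q (r n \<ominus>\<^bsub>A\<^esub> v)) \<le> 2 * q (u n \<ominus>\<^bsub>A\<^esub> v) + 2 * q (u n \<ominus>\<^bsub>A\<^esub> r n)"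
        using q_minus_le[OF D(3) A_minus_closed[OF D(1) rA], of n n n] s_self(2)[OF A_minus_closed[OF rA D(2)], of n]
        by simp
    qed
    show "(\<lambda>n. 2 * q (u n \<ominus>\<^bsub>A\<^esub> v) + 2 * q (u n \<ominus>\<^bsub>A\<^esub> r n)) \<longlonglongrightarrow> 0"
      using tendsto_add[OF tendsto_mult_left[OF D(4), of 2] tendsto_mult_left[OF ur, of 2]] by simp
  qed
  then show ?thesis
    using rA D(2) unfolding r_def[symmetric] converges_def by blast
qed

lemma converges_mult:
  assumes a: "a \<in> carrier A" and u: "converges u v"
  shows "converges (\<lambda>n. a \<otimes>\<^bsub>A\<^esub> u n) (a \<otimes>\<^bsub>A\<^esub> v)"
proof -
  note D = convergesD[OF u]
  obtain M where M: "\<And>b. b \<in> carrier A \<Longrightarrow> q (a \<otimes>\<^bsub>A\<^esub> b) \<le> M * q b"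
    using q_mult_le[OF a] by blast
  have eq: "(a \<otimes>\<^bsub>A\<^esub> u n) \<ominus>\<^bsub>A\<^esub> (a \<otimes>\<^bsub>A\<^esub> v) = a \<otimes>\<^bsub>A\<^esub> (u n \<ominus>\<^bsub>A\<^esub> v)" for n
  proof -
    have "(a \<otimes>\<^bsub>A\<^esub> u n) \<ominus>\<^bsub>A\<^esub> (a \<otimes>\<^bsub>A\<^esub> v) = 
        (\<lambda>k. fst (a \<otimes>\<^bsub>A\<^esub> u n) k - fst (a \<otimes>\<^bsub>A\<^esub> v) k, snd (a \<otimes>\<^bsub>A\<^esub> u n) - snd (a \<otimes>\<^bsub>A\<^esub> v))"
      using a D by (intro A_minus A_closed)
    also have "\<dots> = a \<otimes>\<^bsub>A\<^esub> (u n \<ominus>\<^bsub>A\<^esub> v)"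
      unfolding A_minus[OF D(1) D(2)] by (simp add: fun_eq_iff algebra_simps)
    finally show ?thesis .
  qed
  have "(\<lambda>n. q (a \<otimes>\<^bsub>A\<^esub> (u n \<ominus>\<^bsub>A\<^esub> v))) \<longlonglongrightarrow> 0"
  proof (rule Lim_null_comparison)
    show "\<forall>\<^sub>F n in sequentially. norm (q (a \<otimes>\<^bsub>A\<^esub> (u n \<ominus>\<^bsub>A\<^esub> v))) \<le> M * q (u n \<ominus>\<^bsub>A\<^esub> v)"
      using M[OF D(3)] s_self(2)[OF A_closed(2)[OF a D(3)]] by simp
    show "(\<lambda>n. M * q (u n \<ominus>\<^bsub>A\<^esub> v)) \<longlonglongrightarrow> 0"
      using tendsto_mult_left[OF D(4), of M] by simp
  qed
  moreover have "range (\<lambda>n. a \<otimes>\<^bsub>A\<^esub> u n) \<subseteq> carrier A" "a \<otimes>\<^bsub>A\<^esub> v \<in> carrier A"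
    using a D A_closed(2) by blast+
  ultimately show ?thesis
    unfolding converges_def eq by blast
qed

lemma completion_ip:
  assumes "converges u v" "converges w x"
  shows "ip (hilbert_completion V) (cauchy_class V u) (cauchy_class V w) = s v x"
  using limI[OF converges_ip[OF assms[THEN class_rep_converges]]]
  by (simp add: hilbert_completion_def)

text \<open>The resulting sequence \<open>w\<close> stays unspecified: by
  \<open>completion_ip\<close>, inner products depend only on its limit.\<close>

lemma completion_map_mult:
  assumes "a \<in> carrier A" "converges u v"
  shows "\<exists>w. completion_map V (\<lambda>b. a \<otimes>\<^bsub>A\<^esub> b) (cauchy_class V u) = cauchy_class V w \<and>
    converges w (a \<otimes>\<^bsub>A\<^esub> v)"
  unfolding completion_map_def
  using converges_mult[OF assms(1) class_rep_converges[OF assms(2)]] by blast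

lemma cauchy_class_carrier:
  "converges u v \<Longrightarrow> cauchy_class V u \<in> carrier (hilbert_completion V)"
  by (auto simp: hilbert_completion_def cauchy_class_def intro: quotientI converges_cauchy)

end

section \<open>The universal representation\<close>

text \<open>A vector functional is the ultraweakly continuous functional of the square-summable
  sequence \<xi>, 0, 0, ..., used on both sides.\<close>

lemma vector_functional_tendsto:
  assumes lim: "limitin (subtopology (ultraweak_topology H) S) f T F"
    and \<xi>: "\<xi> \<in> carrier H" and zero: "\<zero>\<^bsub>H\<^esub> \<in> carrier H" "ip H \<zero>\<^bsub>H\<^esub> \<zero>\<^bsub>H\<^esub> = 0"
    and smult_zero: "\<And>\<eta>. \<eta> \<in> carrier H \<Longrightarrow> 0 \<odot>\<^bsub>H\<^esub> \<eta> = \<zero>\<^bsub>H\<^esub>"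
  shows "((\<lambda>i. ip H \<xi> (f i \<xi>)) \<longlongrightarrow> ip H \<xi> (T \<xi>)) F"
proof -
  define \<eta> where "\<eta> n = (if n = 0 then \<xi> else \<zero>\<^bsub>H\<^esub>)" for n :: nat
  have "summable (\<lambda>n. (hnorm H (\<eta> n))\<^sup>2)"
    using zero(2) by (intro summable_finite[of "{0}"]) (auto simp: \<eta>_def hnorm_def)
  then have \<eta>: "\<eta> \<in> square_summable_seqs H"
    using \<xi> zero(1) by (auto simp: square_summable_seqs_def \<eta>_def)
  \<comment> \<open>Homogeneity gives R 0 = 0, so only the term n = 0 survives.\<close>
  have val: "(\<Sum>n. ip H (\<eta> n) (R (\<eta> n))) = ip H \<xi> (R \<xi>)" if R: "R \<in> bounded_ops H" for R
  proof -
    have "R \<zero>\<^bsub>H\<^esub> = R (0 \<odot>\<^bsub>H\<^esub> \<xi>)" by (simp add: smult_zero \<xi>)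
    also have "\<dots> = 0 \<odot>\<^bsub>H\<^esub> R \<xi>" using R \<xi> by (simp add: bounded_ops_def)
    also have "\<dots> = \<zero>\<^bsub>H\<^esub>"
      using R \<xi> by (intro smult_zero) (auto simp: bounded_ops_def)
    finally have "ip H (\<eta> n) (R (\<eta> n)) = 0" if "n \<notin> {0}" for n
      using that zero(2) by (simp add: \<eta>_def)
    then have "(\<Sum>n. ip H (\<eta> n) (R (\<eta> n))) = (\<Sum>n\<in>{0}. ip H (\<eta> n) (R (\<eta> n)))"
      by (intro suminf_finite) auto
    then show ?thesis by (simp add: \<eta>_def)
  qed
  let ?W = "\<lambda>U. {R \<in> bounded_ops H. (\<Sum>n. ip H (\<eta> n) (R (\<eta> n))) \<in> U}"
  have T: "T \<in> bounded_ops H" "T \<in> S"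
    using limitin_topspace[OF lim] by (auto simp: ultraweak_topology_def)
  show ?thesis
  proof (rule topological_tendstoI)
    fix U assume U: "open U" "ip H \<xi> (T \<xi>) \<in> U"
    have "openin (ultraweak_topology H) (?W U)"
      unfolding ultraweak_topology_def using \<eta> U(1)
      by (intro topology_generated_by_Basis) blast
    then have "openin (subtopology (ultraweak_topology H) S) (?W U \<inter> S)"
      by (auto simp: openin_subtopology)
    moreover have "T \<in> ?W U \<inter> S" using T U(2) val by simp
    ultimately have "\<forall>\<^sub>F i in F. f i \<in> ?W U \<inter> S"
      using lim unfolding limitin_def by blast
    then show "\<forall>\<^sub>F i in F. ip H \<xi> (f i \<xi>) \<in> U"
      by eventually_elim (use val in auto)
  qed
qed

context noncompact_lcH
begin

text \<open>For a state \<phi>, the GNS cyclic vector of \<phi> placed in its own summand of the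
  universal space.\<close>

definition cyclic_vector where
  "cyclic_vector \<phi> = (\<lambda>\<psi>\<in>states A. cauchy_class (gns_pre A \<psi>)
     (\<lambda>n. if \<psi> = \<phi> then \<one>\<^bsub>A\<^esub> else \<zero>\<^bsub>A\<^esub>))"

lemma univ_ip:
  "ip (univ_space A) \<xi> \<eta> =
    (\<Sum>\<^sub>\<infinity>\<psi>\<in>states A. ip (hilbert_completion (gns_pre A \<psi>)) (\<xi> \<psi>) (\<eta> \<psi>))"
  by (simp add: univ_space_def hilbert_sum_def)

lemma univ_zero:
  "\<zero>\<^bsub>univ_space A\<^esub> = (\<lambda>\<psi>\<in>states A. cauchy_class (gns_pre A \<psi>) (\<lambda>n. \<zero>\<^bsub>A\<^esub>))"
  by (simp add: univ_space_def hilbert_sum_def hilbert_completion_def gns_pre_def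
      cong: restrict_cong)

lemma univ_smult_zero: "0 \<odot>\<^bsub>univ_space A\<^esub> \<xi> = \<zero>\<^bsub>univ_space A\<^esub>"
  by (simp add: univ_zero) (simp add: univ_space_def hilbert_sum_def hilbert_completion_def gns_pre_def
      cong: restrict_cong)

lemma completion_ip_const:
  assumes "\<psi> \<in> states A" "v \<in> carrier A" "w \<in> carrier A"
  shows "ip (hilbert_completion (gns_pre A \<psi>)) (cauchy_class (gns_pre A \<psi>) (\<lambda>n. v))
    (cauchy_class (gns_pre A \<psi>) (\<lambda>n. w)) = \<psi> (star A v \<otimes>\<^bsub>A\<^esub> w)"
proof -
  interpret gns_state K \<psi> by unfold_locales (fact assms(1))
  show ?thesis
    using completion_ip[OF converges_const converges_const, OF assms(2,3)] by (simp only: s_def)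
qed

text \<open>Square summability holds because all but finitely many components are zero
  vectors.\<close>

lemma univ_const_carrier:
  assumes v: "\<And>\<psi>. \<psi> \<in> states A \<Longrightarrow> v \<psi> \<in> carrier A"
    and fin: "finite {\<psi> \<in> states A. v \<psi> \<noteq> \<zero>\<^bsub>A\<^esub>}"
  shows "(\<lambda>\<psi>\<in>states A. cauchy_class (gns_pre A \<psi>) (\<lambda>n. v \<psi>)) \<in> carrier (univ_space A)"
proof -
  let ?\<xi> = "\<lambda>\<psi>\<in>states A. cauchy_class (gns_pre A \<psi>) (\<lambda>n. v \<psi>)"
  let ?n = "\<lambda>\<psi>. (hnorm (hilbert_completion (gns_pre A \<psi>)) (?\<xi> \<psi>))\<^sup>2"
  have carr: "?\<xi> \<psi> \<in> carrier (hilbert_completion (gns_pre A \<psi>))" if "\<psi> \<in> states A" for \<psi>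
  proof -
    interpret gns_state K \<psi> by unfold_locales (fact that)
    show ?thesis
      using cauchy_class_carrier[OF converges_const[OF v[OF that]]] that by simp
  qed
  have "?n \<psi> = 0" if "\<psi> \<in> states A" "v \<psi> = \<zero>\<^bsub>A\<^esub>" for \<psi>
  proof -
    interpret gns_state K \<psi> by unfold_locales (fact that(1))
    have "\<psi> (star A \<zero>\<^bsub>A\<^esub> \<otimes>\<^bsub>A\<^esub> \<zero>\<^bsub>A\<^esub>) = 0"
      using s_zero by (simp only: s_def)
    then show ?thesis
      using that by (simp add: hnorm_def completion_ip_const[OF that(1)] A_zero_one_closed del: A_fields)
  qed
  then have "?n summable_on states A \<longleftrightarrow> ?n summable_on {\<psi> \<in> states A. v \<psi> \<noteq> \<zero>\<^bsub>A\<^esub>}"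
    by (intro summable_on_cong_neutral) auto
  with fin have "?n summable_on states A" by simp
  with carr show ?thesis
    by (simp add: univ_space_def hilbert_sum_def PiE_iff)
qed

lemma univ_zero_carrier: "\<zero>\<^bsub>univ_space A\<^esub> \<in> carrier (univ_space A)"
  unfolding univ_zero by (intro univ_const_carrier A_zero_one_closed) simp

lemma univ_zero_ip: "ip (univ_space A) \<zero>\<^bsub>univ_space A\<^esub> \<zero>\<^bsub>univ_space A\<^esub> = 0"
  unfolding univ_ip
proof (rule infsum_0)
  fix \<psi> assume \<psi>: "\<psi> \<in> states A"
  interpret gns_state K \<psi> by unfold_locales (fact \<psi>)
  show "ip (hilbert_completion V) (\<zero>\<^bsub>univ_space A\<^esub> \<psi>) (\<zero>\<^bsub>univ_space A\<^esub> \<psi>) = 0"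
    using s_zero \<psi>
    by (simp add: univ_zero completion_ip_const A_zero_one_closed s_def del: A_fields)
qed

lemma cyclic_vector_carrier: "cyclic_vector \<phi> \<in> carrier (univ_space A)"
proof -
  have "finite {\<psi> \<in> states A. (if \<psi> = \<phi> then \<one>\<^bsub>A\<^esub> else \<zero>\<^bsub>A\<^esub>) \<noteq> \<zero>\<^bsub>A\<^esub>}"
    by (rule finite_subset[of _ "{\<phi>}"]) auto
  then show ?thesis
    unfolding cyclic_vector_def using A_zero_one_closed
    by (intro univ_const_carrier) (auto simp del: A_fields)
qed

text \<open>The universal representation acts in each summand separately. The summand of \<phi>
  contributes \<phi>(1* a 1), the others 0, so every state is a vector state.\<close>

lemma cyclic_vector_ip:
  assumes \<phi>: "\<phi> \<in> states A" and a: "a \<in> carrier A"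
  shows "ip (univ_space A) (cyclic_vector \<phi>) (univ_rep A a (cyclic_vector \<phi>)) = \<phi> a"
proof -
  let ?v = "\<lambda>\<psi>. if \<psi> = \<phi> then \<one>\<^bsub>A\<^esub> else \<zero>\<^bsub>A\<^esub>"
  have comp: "ip (hilbert_completion (gns_pre A \<psi>)) (cyclic_vector \<phi> \<psi>)
      (univ_rep A a (cyclic_vector \<phi>) \<psi>) = \<psi> (star A (?v \<psi>) \<otimes>\<^bsub>A\<^esub> (a \<otimes>\<^bsub>A\<^esub> ?v \<psi>))"
    if \<psi>: "\<psi> \<in> states A" for \<psi>
  proof -
    interpret gns_state K \<psi> by unfold_locales (fact \<psi>)
    have v: "converges (\<lambda>n. ?v \<psi>) (?v \<psi>)"
      using A_zero_one_closed by (intro converges_const) (simp del: A_fields)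
    obtain w where w: "completion_map V (\<lambda>b. a \<otimes>\<^bsub>A\<^esub> b) (cauchy_class V (\<lambda>n. ?v \<psi>)) = cauchy_class V w"
        "converges w (a \<otimes>\<^bsub>A\<^esub> ?v \<psi>)"
      using completion_map_mult[OF a v] by blast
    have "cyclic_vector \<phi> \<psi> = cauchy_class V (\<lambda>n. ?v \<psi>)"
      using \<psi> by (simp add: cyclic_vector_def del: A_fields)
    moreover from this have "univ_rep A a (cyclic_vector \<phi>) \<psi> = cauchy_class V w"
      using \<psi> cyclic_vector_carrier w(1) by (simp add: univ_rep_def del: A_fields)
    ultimately show ?thesis
      using completion_ip[OF v w(2)] by (simp only: s_def)
  qed
  have zero: "\<psi> (star A (?v \<psi>) \<otimes>\<^bsub>A\<^esub> (a \<otimes>\<^bsub>A\<^esub> ?v \<psi>)) = 0" if "\<psi> \<in> states A" "\<psi> \<noteq> \<phi>" for \<psi>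
  proof -
    interpret gns_state K \<psi> by unfold_locales (fact that(1))
    have "a \<otimes>\<^bsub>A\<^esub> \<zero>\<^bsub>A\<^esub> = \<zero>\<^bsub>A\<^esub>" by simp
    then show ?thesis
      using s_zero that(2) by (simp add: s_def del: A_fields)
  qed
  have "ip (univ_space A) (cyclic_vector \<phi>) (univ_rep A a (cyclic_vector \<phi>)) =
      (\<Sum>\<^sub>\<infinity>\<psi>\<in>states A. \<psi> (star A (?v \<psi>) \<otimes>\<^bsub>A\<^esub> (a \<otimes>\<^bsub>A\<^esub> ?v \<psi>)))"
    unfolding univ_ip by (intro infsum_cong comp)
  also have "\<dots> = (\<Sum>\<^sub>\<infinity>\<psi>\<in>{\<phi>}. \<psi> (star A (?v \<psi>) \<otimes>\<^bsub>A\<^esub> (a \<otimes>\<^bsub>A\<^esub> ?v \<psi>)))"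
    using zero \<phi> by (intro infsum_cong_neutral) (auto simp del: A_fields)
  also have "\<dots> = \<phi> (star A (?v \<phi>) \<otimes>\<^bsub>A\<^esub> (a \<otimes>\<^bsub>A\<^esub> ?v \<phi>))"
    by (simp del: A_fields)
  also have "star A (?v \<phi>) \<otimes>\<^bsub>A\<^esub> (a \<otimes>\<^bsub>A\<^esub> ?v \<phi>) = a" by simp
  finally show ?thesis .
qed

text \<open>Evaluation at \<open>k\<close> is a state, hence a vector state, so it carries the
  ultraweak limit and the operator inequality to scalars.\<close>

lemma nonstandard_frame_pointwise:
  assumes "nonstandard_frame A (self_module (C0 K)) J xs" and k: "k \<in> topspace K"
  shows "xs \<in> J \<rightarrow> carrier (C0 K) \<and> (\<exists>L>0. ((\<lambda>j. (cmod (xs j k))\<^sup>2) has_sum L) J)"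
proof -
  have carr: "carrier (self_module (C0 K)) = carrier (C0 K)"
    by (simp add: self_module_def)
  obtain x where x: "x \<in> carrier (C0 K)" "x k = 1"
    using C0_peak[OF locally_compact Hausdorff k] by blast
  let ?s = "frame_sum A (self_module (C0 K)) xs x"
  obtain c T where xs: "xs \<in> J \<rightarrow> carrier (C0 K)" and c: "c > 0"
      and lim: "limitin (subtopology (ultraweak_topology (univ_space A)) (enveloping_vN A))
          (\<lambda>F. univ_rep A (?s F)) T (finite_subsets_at_top J)"
      and le: "op_le (univ_space A)
          (univ_rep A (complex_of_real c \<odot>\<^bsub>A\<^esub> ip (self_module (C0 K)) x x)) T"
    using assms(1) x(1) unfolding nonstandard_frame_def carr by blast
  define \<phi> where "\<phi> = restrict (ev k) (carrier A)"
  have \<phi>: "\<phi> \<in> states A" unfolding \<phi>_def by (rule ev_state)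
  \<comment> \<open>\<open>T\<close> need not come from the algebra, so \<open>ev k\<close> does not
    apply to it; its vector state value takes that place.\<close>
  define l where "l = ip (univ_space A) (cyclic_vector \<phi>) (T (cyclic_vector \<phi>))"
  have val: "ip (univ_space A) (cyclic_vector \<phi>) (univ_rep A a (cyclic_vector \<phi>)) = ev k a"
    if "a \<in> carrier A" for a
    using cyclic_vector_ip[OF \<phi> that] that by (simp only: \<phi>_def restrict_apply')
  have "((\<lambda>F. ip (univ_space A) (cyclic_vector \<phi>) (univ_rep A (?s F) (cyclic_vector \<phi>)))
      \<longlongrightarrow> l) (finite_subsets_at_top J)"
    unfolding l_def
    by (rule vector_functional_tendsto[OF lim cyclic_vector_carrier univ_zero_carrier
          univ_zero_ip univ_smult_zero])
  moreover have "\<forall>\<^sub>F F in finite_subsets_at_top J.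
      ip (univ_space A) (cyclic_vector \<phi>) (univ_rep A (?s F) (cyclic_vector \<phi>)) = ev k (?s F)"
    by (intro eventually_finite_subsets_at_top_weakI val ev_frame_sum(1)[OF xs x(1)])
  ultimately have "((\<lambda>F. ev k (?s F)) \<longlongrightarrow> l) (finite_subsets_at_top J)"
    by (rule Lim_transform_eventually)
  moreover have "l - complex_of_real c \<in> \<real>\<^sub>\<ge>\<^sub>0"
  proof -
    let ?b = "complex_of_real c \<odot>\<^bsub>A\<^esub> ip (self_module (C0 K)) x x"
    have "?b \<in> carrier A"
      using x(1) by (auto simp: self_module_def intro!: C0_closed)
    then have "ip (univ_space A) (cyclic_vector \<phi>) (univ_rep A ?b (cyclic_vector \<phi>)) = complex_of_real c"
      using val ev_ip[of k _ x] x(2) by (simp del: A_fields)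
    then show ?thesis
      using le cyclic_vector_carrier[of \<phi>] unfolding op_le_def l_def by metis
  qed
  ultimately show ?thesis
    using frame_pointwise_limit[OF xs x] c xs by blast
qed

end

theorem theorem4p1:
  fixes K :: "'k topology" and J :: "'j set" and xs :: "'j \<Rightarrow> 'k \<Rightarrow> complex"
  assumes "class_K_IV K"
  shows "\<not> standard_frame (unitalization (C0 K)) (self_module (C0 K)) J xs \<and>
         \<not> nonstandard_frame (unitalization (C0 K)) (self_module (C0 K)) J xs"
proof -
  interpret noncompact_lcH K
    using assms class_K_IV_noncompact by unfold_locales (auto simp: class_K_IV_def)
  \<comment> \<open>The pointwise lemmas yield
    \<open>xs \<in> J \<rightarrow> carrier (C0 K)\<close> only at a given point. One exists, since
    the empty set is compact and some point lies outside it.\<close>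
  obtain k where "k \<in> topspace K"
    using class_K_IV_sigma_compact_proper[OF assms sigma_compact_in_compactin[of K "{}"]] by auto
  then show ?thesis
    using standard_frame_pointwise nonstandard_frame_pointwise
      class_K_IV_not_pointwise_frame[OF assms, of xs J] by blast
qed

end
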